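(* Let $n\ge 1$, let $1<p,q<\infty$, and let $u,v$ be non-negative measurable functions on $\mathbb{R}^n$. Suppose that the Pitt inequality $$\|u^{1/q}\,\widehat f\,\|_q\le C\|v^{1/p} f\|_p$$ holds for every $f\in C_0^\infty(\mathbb{R}^n)$, with a constant $C$ independent of $f$. Then the following hold. (1) For every constant $0<c<\pi/2$, $$\sup_{A}\left(\int_{cA^{*}}u(\xi)\,d\xi\right)^{1/q}\left(\int_{A}v^{1-p'}(x)\,dx\right)^{1/p'}<\infty,$$ where the supremum is over all convex bodies $A\subset\mathbb{R}^n$ that are centrally symmetric with respect to the origin, and $A^{*}$ is the polar set of $A$. (2) If the weights $u(x)=u_0(|x|)$ and $v(x)=v_0(|x|)$ are radial, then $$\sup_{s>0}\left(\int_{|x|<s}u(x)\,dx\right)^{1/q}\left(\int_{|x|<c_n/s}v^{1-p'}(x)\,dx\right)^{1/p'}<\infty,$$ where $c_n$ is any positive number less than $q_{n/2-1}$, the first positive zero of the Bessel function $J_{n/2-1}(t)$. In particular, $q_{n/2-1}\ge \pi/2$. (3) The result of part (1) also holds if the sets $A$ and $cA^{*}$ are replaced by unions of disjoint translates: for all positive integers $N_1,N_2$ and every $0<c<\pi/2$, $$\sup\left(\int_{A_2}u(\xi)\,d\xi\right)^{1/q}\left(\int_{A_1}v^{1-p'}(x)\,dx\right)^{1/p'}<\infty,$$ where $A_1=\bigcup_{j=1}^{N_1}(A+x_j)$, $A_2=\bigcup_{j=1}^{N_2}(cA^{*}+\xi_j)$, and the supremum is over all convex bodies $A$ centrally symmetric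 with respect to the origin and all $x_j,\xi_j\in\mathbb{R}^n$ for which the translates $A+x_j$ are pairwise disjoint and the translates $cA^{*}+\xi_j$ are pairwise disjoint.
   Context: The Fourier transform is $\widehat f(\xi)=\int_{\mathbb{R}^n}e^{ix\xi}f(x)\,dx$, where $x\xi$ is the Euclidean inner product. $\|\cdot\|_p$ is the norm of $L^p(\mathbb{R}^n)$ and $p'=p/(p-1)$. For $A\subset\mathbb{R}^n$ the polar set is $A^{*}=\{\xi\in\mathbb{R}^n: |x\xi|\le 1 \text{ for all } x\in A\}$. $J_\alpha$ is the Bessel function of the first kind of order $\alpha$.
   Formalization: It is additionally assumed that almost every point has a neighbourhood on which v is integrable; without it the claim fails, e.g. for finite v>0 not integrable on any ball (the right side is then infinite for all f≠0) and u=|ξ|^{-n}. *)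

theory Defs
  imports "HOL-Analysis.Analysis"
begin

text \<open>Powers on [0,\<open>\<infinity>\<close>] with the usual conventions: a negative power of 0 is \<open>\<infinity>\<close> (whereas
  \<open>0 powr a = 0\<close> for all real a) and a positive power of \<open>\<infinity>\<close> is \<open>\<infinity>\<close>.\<close>

definition ennpowr :: "ennreal \<Rightarrow> real \<Rightarrow> ennreal"  (infixr "epowr" 80) where
  "x epowr a = (if a = 0 then 1
                else if (x = 0 \<and> a < 0) \<or> (x = top \<and> 0 < a) then top
                else ennreal (enn2real x powr a))"

definition conj_exponent :: "real \<Rightarrow> real" where
  "conj_exponent p = p / (p - 1)"

definition Lp_norm :: "real \<Rightarrow> ('a::euclidean_space \<Rightarrow> 'b::real_normed_vector) \<Rightarrow> ennreal" where
  "Lp_norm p g = (\<integral>\<^sup>+x. ennreal (norm (g x) powr p) \<partial>lebesgue) epowr (1 / p)"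

definition fourier :: "('a::euclidean_space \<Rightarrow> complex) \<Rightarrow> 'a \<Rightarrow> complex" where
  "fourier f \<xi> = (LINT x|lebesgue. exp (\<i> * complex_of_real (x \<bullet> \<xi>)) * f x)"

fun iter_partial ::
  "'a list \<Rightarrow> ('a::euclidean_space \<Rightarrow> 'b::real_normed_vector) \<Rightarrow> 'a \<Rightarrow> 'b" where
  "iter_partial [] f = f"
| "iter_partial (b # bs) f = (\<lambda>x. frechet_derivative (iter_partial bs f) (at x) b)"

text \<open>Requiring every iterated partial derivative to be totally differentiable makes all of them
  continuous, so this is the class of infinitely differentiable functions.\<close>

definition C_infinity :: "('a::euclidean_space \<Rightarrow> 'b::real_normed_vector) \<Rightarrow> bool" where
  "C_infinity f \<longleftrightarrow> (\<forall>bs x. set bs \<subseteq> Basis \<longrightarrow> iter_partial bs f differentiable (at x))"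

definition test_functions :: "('a::euclidean_space \<Rightarrow> complex) set" where
  "test_functions = {f. C_infinity f \<and> compact (closure {x. f x \<noteq> 0})}"

definition pitt_inequality ::
  "real \<Rightarrow> real \<Rightarrow> ('a::euclidean_space \<Rightarrow> real) \<Rightarrow> ('a \<Rightarrow> real) \<Rightarrow> bool" where
  "pitt_inequality p q u v \<longleftrightarrow>
     (\<exists>C::real. \<forall>f\<in>test_functions.
        Lp_norm q (\<lambda>\<xi>. (u \<xi> powr (1 / q)) *\<^sub>R fourier f \<xi>)
          \<le> ennreal C * Lp_norm p (\<lambda>x. (v x powr (1 / p)) *\<^sub>R f x))"

definition symmetric_convex_body :: "'a::euclidean_space set \<Rightarrow> bool" where
  "symmetric_convex_body A \<longleftrightarrow>
     compact A \<and> convex A \<and> interior A \<noteq> {} \<and> (\<forall>x\<in>A. - x \<in> A)"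

definition polar :: "'a::euclidean_space set \<Rightarrow> 'a set" where
  "polar A = {\<xi>. \<forall>x\<in>A. \<bar>x \<bullet> \<xi>\<bar> \<le> 1}"

text \<open>The power series of the Bessel function of the first kind, of real order a and for t > 0.\<close>

definition bessel_J :: "real \<Rightarrow> real \<Rightarrow> real" where
  "bessel_J a t =
     (\<Sum>k. (- 1) ^ k * rGamma (real k + a + 1) / fact k * (t / 2) powr (2 * real k + a))"

definition bessel_J_first_zero :: "real \<Rightarrow> real" where
  "bessel_J_first_zero a = (LEAST t. 0 < t \<and> bessel_J a t = 0)"

text \<open>The two-weight quantity \<open>(\<integral>\<^sub>B u)\<^bsup>1/q\<^esup> (\<integral>\<^sub>A v\<^bsup>1-p'\<^esup>)\<^bsup>1/p'\<^esup>\<close>, with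
  \<open>0 \<cdot> \<infinity> = 0\<close> as in \<open>ennreal\<close>.\<close>

definition weight_product ::
  "real \<Rightarrow> real \<Rightarrow> ('a::euclidean_space \<Rightarrow> real) \<Rightarrow> ('a \<Rightarrow> real) \<Rightarrow> 'a set \<Rightarrow> 'a set \<Rightarrow> ennreal" where
  "weight_product p q u v B A =
     (\<integral>\<^sup>+\<xi>\<in>B. ennreal (u \<xi>) \<partial>lebesgue) epowr (1 / q) *
     (\<integral>\<^sup>+x\<in>A. ennreal (v x) epowr (1 - conj_exponent p) \<partial>lebesgue) epowr (1 / conj_exponent p)"

text \<open>Every locally integrable function satisfies the next condition, and so does a function that
  is locally integrable off a closed null set. If v is not integrable on any ball, then
  \<open>\<parallel>v\<^bsup>1/p\<^esup> f\<parallel>\<^sub>p = \<infinity>\<close> for every test function f other than 0, so that the Pitt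
  inequality says nothing about u.\<close>

definition ae_locally_integrable :: "('a::euclidean_space \<Rightarrow> real) \<Rightarrow> bool" where
  "ae_locally_integrable v \<longleftrightarrow>
     (AE x in lebesgue. \<exists>r>0. set_integrable lebesgue (ball x r) v)"

end

(* The Pitt inequality extends by Fatou's lemma and dominated convergence from test functions to all
   integrable f with finite weighted norm. Apply it to f = v^(1-p') 1_A, truncated in height and
   modulated: for a translate of a symmetric body A and xi in a translate of c A^*, the phase stays
   in [-c, c], so |f^(xi)| >= cos c * int f, and dividing by the norm gives parts (1) and (3).

   For radial f, int f(x) cos(x xi) dx = int f(x) Phi(|x| |xi|) dx, where
   Phi(t) = sum_k (-t^2/4)^k / (k! (n/2)_k) is t^(1-n/2) J_(n/2-1)(t) up to a constant. This is
   proved termwise from the moments of rotation invariant functions. Phi is bounded below by a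
   positive constant on [0, c] when c lies below the first zero, which gives part (2). *)
theory Submission
  imports Defs
begin

section \<open>A supply of test functions\<close>

text \<open>The obstacle is that v^(1-p') 1_A is far from a test function: it may be unbounded or
  infinite, and v is integrable only near almost every point, so finite weighted norms of smooth
  approximants are secured only inside suitable balls. Hence the approximation multiplies by bumps
  living on balls where v is integrable, and exhausts the space afterwards. Truncation serves the
  final estimate too: h = min(v^(1-p'), height) 1_A satisfies v h^p <= h pointwise, because
  (1-p')(p-1) = -1. With I = int h and a = int_B u this gives a^(1/q) \<kappa> I <= C^(1/q) I^(1/p).
  Cancelling I^(1/p) needs 0 < I < \<infinity> and leaves I^(1/p'), with a bound that depends
  neither on the sets nor on the height. The bound pi/2 for the first zero is proved without the
  inequality: for n = 1 the kernel Phi is cos, and for n >= 2 an alternating series keeps Phi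
  positive for 0 <= t < 2. That a zero exists at all follows because an average of Phi against a
  Gamma weight is negative.\<close>

definition flat_exp :: "nat \<Rightarrow> real \<Rightarrow> real" where
  "flat_exp k t = (if 0 < t then exp (- inverse t) * inverse t ^ k else 0)"

text \<open>With y = 1/t this is the decay of y^(k+1) e^(-y) at infinity. It is the difference
  quotient at 0, the only point where differentiability of \<open>flat_exp\<close> is in
  doubt.\<close>

lemma flat_exp_over_self_tendsto_0: "((\<lambda>t. inverse t * flat_exp k t) \<longlongrightarrow> 0) (at 0)"
proof -
  have "((\<lambda>y::real. y ^ (k + 1) / exp y) \<longlongrightarrow> 0) at_top"
    by (rule tendsto_power_div_exp_0)
  then have "((\<lambda>t::real. inverse t ^ (k + 1) / exp (inverse t)) \<longlongrightarrow> 0) (at_right 0)"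
    by (rule filterlim_compose) (rule filterlim_inverse_at_top_right)
  moreover have "\<forall>\<^sub>F t in at_right 0. inverse t ^ (k + 1) / exp (inverse t) = inverse t * flat_exp k t"
    unfolding eventually_at_right_field
    by (intro exI[of _ 1]) (auto simp: flat_exp_def exp_minus field_simps)
  ultimately have R: "((\<lambda>t. inverse t * flat_exp k t) \<longlongrightarrow> 0) (at_right 0)"
    by (rule Lim_transform_eventually)
  have "\<forall>\<^sub>F t in at_left 0. (\<lambda>_. 0) t = inverse t * flat_exp k t"
    unfolding eventually_at_left_field by (intro exI[of _ "-1"]) (auto simp: flat_exp_def)
  then have L: "((\<lambda>t. inverse t * flat_exp k t) \<longlongrightarrow> 0) (at_left 0)"
    by (rule Lim_transform_eventually[OF tendsto_const])
  show ?thesis using L R by (simp add: filterlim_at_split)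
qed

text \<open>Indexing by the power of 1/t makes the family closed under differentiation up to linear
  combinations, so higher derivatives create no new functions.\<close>

lemma flat_exp_has_real_derivative:
  "(flat_exp k has_real_derivative flat_exp (k + 2) t - k * flat_exp (k + 1) t) (at t)"
proof -
  consider "t > 0" | "t < 0" | "t = 0" by linarith
  then show ?thesis
  proof cases
    case 1
    have "((\<lambda>t. exp (- inverse t) * inverse t ^ k) has_real_derivative
        flat_exp (k + 2) t - k * flat_exp (k + 1) t) (at t)"
    proof -
      have inv: "(inverse has_real_derivative - ((inverse t)\<^sup>2)) (at t)"
        using DERIV_inverse[of t] 1 by (simp add: numeral_2_eq_2)
      have "inverse t ^ Suc (k - 1) = inverse t ^ k \<or> k = 0" by (cases k) auto
      then show ?thesis
        by (intro DERIV_cong[OF DERIV_mult[OF DERIV_chain2[OF DERIV_exp DERIV_minus[OF inv]]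
            DERIV_power[OF inv]]]) (use 1 in \<open>auto simp: flat_exp_def algebra_simps power2_eq_square\<close>)
    qed
    then show ?thesis
      by (rule has_field_derivative_transform_within_open[of _ _ _ "{0<..}"])
         (use 1 in \<open>auto simp: flat_exp_def\<close>)
  next
    case 2
    have "((\<lambda>t. 0) has_real_derivative flat_exp (k + 2) t - k * flat_exp (k + 1) t) (at t)"
      using 2 by (auto simp: flat_exp_def)
    then show ?thesis
      by (rule has_field_derivative_transform_within_open[of _ _ _ "{..<0}"])
         (use 2 in \<open>auto simp: flat_exp_def\<close>)
  next
    case 3
    then show ?thesis
      using flat_exp_over_self_tendsto_0[of k]
      by (simp add: has_field_derivative_iff flat_exp_def[of _ 0] divide_inverse mult.commute)
  qed
qed

text \<open>A syntactic class closed under directional derivatives, so that smoothness becomes an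
  induction over the list of partials. The rule \<open>Re\<close> is there because the chain rule
  for \<open>flat_exp k (Re (f x))\<close> produces the factor \<open>Re (f' x b)\<close>.\<close>

inductive smooth_elem :: "('a::euclidean_space \<Rightarrow> complex) \<Rightarrow> bool" where
  linear: "bounded_linear f \<Longrightarrow> smooth_elem f"
| const: "smooth_elem (\<lambda>x. c)"
| add: "smooth_elem f \<Longrightarrow> smooth_elem g \<Longrightarrow> smooth_elem (\<lambda>x. f x + g x)"
| mult: "smooth_elem f \<Longrightarrow> smooth_elem g \<Longrightarrow> smooth_elem (\<lambda>x. f x * g x)"
| Re: "smooth_elem f \<Longrightarrow> smooth_elem (\<lambda>x. complex_of_real (Re (f x)))"
| flat: "smooth_elem f \<Longrightarrow> smooth_elem (\<lambda>x. complex_of_real (flat_exp k (Re (f x))))"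

lemma smooth_elem_derivative:
  "smooth_elem f \<Longrightarrow> \<exists>f'. (\<forall>x. (f has_derivative f' x) (at x)) \<and> (\<forall>b. smooth_elem (\<lambda>x. f' x b))"
proof (induction rule: smooth_elem.induct)
  case (linear f)
  then show ?case
    by (intro exI[of _ "\<lambda>x. f"]) (auto intro: bounded_linear_imp_has_derivative smooth_elem.const)
next
  case (const c)
  show ?case by (intro exI[of _ "\<lambda>x y. 0"]) (auto intro: smooth_elem.const)
next
  case (add f g)
  then obtain f' g' where "\<forall>x. (f has_derivative f' x) (at x)" "\<forall>b. smooth_elem (\<lambda>x. f' x b)"
    "\<forall>x. (g has_derivative g' x) (at x)" "\<forall>b. smooth_elem (\<lambda>x. g' x b)" by auto
  then show ?case
    by (intro exI[of _ "\<lambda>x b. f' x b + g' x b"]) (auto intro: has_derivative_add smooth_elem.add)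
next
  case (mult f g)
  then obtain f' g' where *: "\<forall>x. (f has_derivative f' x) (at x)" "\<forall>b. smooth_elem (\<lambda>x. f' x b)"
    "\<forall>x. (g has_derivative g' x) (at x)" "\<forall>b. smooth_elem (\<lambda>x. g' x b)" by auto
  show ?case
    by (intro exI[of _ "\<lambda>x b. f x * g' x b + f' x b * g x"])
       (use * in \<open>auto intro!: has_derivative_mult smooth_elem.add smooth_elem.mult mult(1,2)\<close>)
next
  case (Re f)
  then obtain f' where *: "\<forall>x. (f has_derivative f' x) (at x)" "\<forall>b. smooth_elem (\<lambda>x. f' x b)" by auto
  have "bounded_linear (\<lambda>z. complex_of_real (Re z))"
    using bounded_linear_compose[OF bounded_linear_of_real bounded_linear_Re] .
  from bounded_linear.has_derivative[OF this] show ?case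
    by (intro exI[of _ "\<lambda>x b. complex_of_real (Re (f' x b))"]) (use * in \<open>auto intro: smooth_elem.Re\<close>)
next
  case (flat f k)
  then obtain f' where *: "\<forall>x. (f has_derivative f' x) (at x)" "\<forall>b. smooth_elem (\<lambda>x. f' x b)" by auto
  have *: "((\<lambda>x. complex_of_real (flat_exp k (Re (f x)))) has_derivative
      (\<lambda>b. complex_of_real (Re (f' x b)) * (complex_of_real (flat_exp (k + 2) (Re (f x)))
         + (- of_nat k) * complex_of_real (flat_exp (k + 1) (Re (f x)))))) (at x)" for x
  proof -
    have "((\<lambda>x. Re (f x)) has_derivative (\<lambda>b. Re (f' x b))) (at x)"
      using * by (intro bounded_linear.has_derivative[OF bounded_linear_Re]) auto
    from has_derivative_compose[OF this flat_exp_has_real_derivative[unfolded has_field_derivative_def]]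
    have "((\<lambda>x. flat_exp k (Re (f x))) has_derivative (\<lambda>b.
        (flat_exp (k + 2) (Re (f x)) - k * flat_exp (k + 1) (Re (f x))) * Re (f' x b))) (at x)"
      by simp
    from bounded_linear.has_derivative[OF bounded_linear_of_real this]
    show ?thesis
      by (rule has_derivative_eq_rhs) (simp add: fun_eq_iff algebra_simps)
  qed
  show ?case
    by (intro exI, rule conjI, rule allI, rule *)
       (intro allI smooth_elem.mult smooth_elem.add smooth_elem.Re smooth_elem.flat smooth_elem.const;
         use \<open>\<forall>b. smooth_elem (\<lambda>x. f' x b)\<close> flat.hyps in blast)
qed

lemma smooth_elem_imp_C_infinity:
  assumes "smooth_elem f" shows "C_infinity f"
proof -
  have "smooth_elem (iter_partial bs f)" for bs
  proof (induction bs)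
    case (Cons b bs)
    then obtain f' where *: "\<forall>x. (iter_partial bs f has_derivative f' x) (at x)" "\<forall>b. smooth_elem (\<lambda>x. f' x b)"
      using smooth_elem_derivative by blast
    then have "frechet_derivative (iter_partial bs f) (at x) = f' x" for x
      by (metis frechet_derivative_at)
    then show ?case using * by simp
  qed (use assms in simp)
  then show ?thesis
    unfolding C_infinity_def using smooth_elem_derivative differentiable_def by blast
qed

lemma smooth_elem_real_polynomial_function:
  "real_polynomial_function f \<Longrightarrow> smooth_elem (\<lambda>x. complex_of_real (f x))"
proof (induction rule: real_polynomial_function.induct)
  case (linear f)
  then show ?case
    by (intro smooth_elem.linear bounded_linear_compose[OF bounded_linear_of_real])
qed (auto intro: smooth_elem.intros)

lemma smooth_elem_polynomial_function:
  fixes f :: "'a::euclidean_space \<Rightarrow> complex"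
  assumes "polynomial_function f" shows "smooth_elem f"
proof -
  have "real_polynomial_function (Re \<circ> f)" "real_polynomial_function (Im \<circ> f)"
    using assms bounded_linear_Re bounded_linear_Im unfolding polynomial_function_def by blast+
  then have "smooth_elem (\<lambda>x. complex_of_real (Re (f x)) + \<i> * complex_of_real (Im (f x)))"
    using smooth_elem_real_polynomial_function[of "Re \<circ> f"] smooth_elem_real_polynomial_function[of "Im \<circ> f"]
    by (auto intro!: smooth_elem.add smooth_elem.mult smooth_elem.const)
  then show ?thesis by (simp flip: complex_eq)
qed

lemma smooth_elem_sum:
  "(\<And>i. i \<in> I \<Longrightarrow> smooth_elem (f i)) \<Longrightarrow> smooth_elem (\<lambda>x. \<Sum>i\<in>I. f i x)"
  by (induction I rule: infinite_finite_induct) (auto intro: smooth_elem.intros)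

text \<open>The squared distance is a polynomial in the coordinates, which puts the bump into
  \<open>smooth_elem\<close>; for r > 0 the argument is positive exactly on the open ball.\<close>

definition ball_bump :: "'a::euclidean_space \<Rightarrow> real \<Rightarrow> 'a \<Rightarrow> real" where
  "ball_bump a r x = flat_exp 0 (r\<^sup>2 - (dist a x)\<^sup>2)"

lemma smooth_elem_ball_bump: "smooth_elem (\<lambda>x. complex_of_real (ball_bump a r x))"
proof -
  have "real_polynomial_function (\<lambda>x::'a. (a - x) \<bullet> b)" for b
    unfolding inner_diff_left
    by (intro real_polynomial_function_diff real_polynomial_function.intros bounded_linear_inner_left)
  then have "real_polynomial_function (\<lambda>x::'a. r\<^sup>2 - (\<Sum>b\<in>Basis. ((a - x) \<bullet> b)\<^sup>2))"
    by (intro real_polynomial_function_diff real_polynomial_function_sum real_polynomial_function_power)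
       (auto intro: real_polynomial_function.intros)
  from smooth_elem.flat[OF smooth_elem_real_polynomial_function[OF this], of 0] show ?thesis
    by (simp add: ball_bump_def dist_norm norm_eq_sqrt_inner[of "a - _"] euclidean_inner[of "a - _" "a - _"] power2_eq_square sum_nonneg)
qed

lemma ball_bump_pos_iff: "0 < r \<Longrightarrow> 0 < ball_bump a r x \<longleftrightarrow> x \<in> ball a r"
  using power_strict_mono[of "dist a x" r 2] power_less_imp_less_base[of "dist a x" 2 r]
  by (auto simp: ball_bump_def flat_exp_def)

lemma ball_bump_nonneg: "0 \<le> ball_bump a r x"
  by (simp add: ball_bump_def flat_exp_def)

lemma ball_bump_le_1: "ball_bump a r x \<le> 1"
  by (simp add: ball_bump_def flat_exp_def)

lemma continuous_on_ball_bump: "continuous_on S (ball_bump a r)"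
proof -
  have "continuous_on UNIV (flat_exp 0)"
    using flat_exp_has_real_derivative DERIV_isCont continuous_at_imp_continuous_on by blast
  then have "continuous_on S (\<lambda>x. flat_exp 0 (r\<^sup>2 - (dist a x)\<^sup>2))"
    by (rule continuous_on_compose2) (auto intro!: continuous_intros)
  then show ?thesis by (simp add: ball_bump_def[abs_def])
qed

section \<open>Extension of the Pitt inequality to integrable functions\<close>

lemma epowr_ennreal: "0 \<le> x \<Longrightarrow> 0 < r \<Longrightarrow> ennreal x epowr r = ennreal (x powr r)"
  by (simp add: ennpowr_def)

lemma epowr_top: "0 < r \<Longrightarrow> top epowr r = top"
  by (simp add: ennpowr_def)

lemma epowr_zero: "0 < r \<Longrightarrow> 0 epowr r = 0"
  by (simp add: ennpowr_def)

lemma epowr_mono: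
  assumes "x \<le> y" "0 < r" shows "x epowr r \<le> y epowr r"
proof (cases y)
  case (real b)
  with assms obtain a where "x = ennreal a" "0 \<le> a" by (cases x) (auto simp: top_unique)
  with real assms show ?thesis by (auto simp: epowr_ennreal intro!: ennreal_leI powr_mono2)
qed (simp add: epowr_top assms)

lemma epowr_epowr_inverse:
  assumes "0 < r" shows "(x epowr r) epowr (1 / r) = x"
proof (cases x)
  case (real a)
  with assms show ?thesis by (simp add: epowr_ennreal powr_powr)
qed (simp add: epowr_top assms)

lemma epowr_le_imp_le:
  assumes "x epowr r \<le> y" "0 < r" shows "x \<le> y epowr (1 / r)"
  using epowr_mono[OF assms(1), of "1 / r"] assms(2) by (simp add: epowr_epowr_inverse)

text \<open>For r > 0 the power is an order automorphism of [0, \<infinity>] with inverse the power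
  1/r, hence commutes with suprema.\<close>

lemma epowr_SUP:
  assumes "0 < r" shows "(SUP i. f i) epowr r = (SUP i. f i epowr r)"
proof (rule antisym)
  have "f i \<le> (SUP i. f i epowr r) epowr (1 / r)" for i
    using assms by (intro epowr_le_imp_le SUP_upper) auto
  then have "(SUP i. f i) \<le> (SUP i. f i epowr r) epowr (1 / r)"
    by (rule SUP_least)
  from epowr_mono[OF this assms] show "(SUP i. f i) epowr r \<le> (SUP i. f i epowr r)"
    using epowr_epowr_inverse[of "1 / r" "(SUP i. f i epowr r)"] assms by simp
qed (intro SUP_least epowr_mono SUP_upper UNIV_I assms)

text \<open>The q-th power of the inequality for a single f. The right side is a Bochner integral,
  which defaults to 0 for a non-integrable integrand, so this expresses the weighted bound only
  together with integrability of v |f|^p.\<close>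

definition pitt_for ::
  "real \<Rightarrow> real \<Rightarrow> ('a::euclidean_space \<Rightarrow> real) \<Rightarrow> ('a \<Rightarrow> real) \<Rightarrow> real \<Rightarrow> ('a \<Rightarrow> complex) \<Rightarrow> bool" where
  "pitt_for p q u v C f \<longleftrightarrow>
     (\<integral>\<^sup>+\<xi>. ennreal (u \<xi> * norm (fourier f \<xi>) powr q) \<partial>lebesgue)
       \<le> ennreal (C * (LINT x|lebesgue. v x * norm (f x) powr p) powr (q / p))"

lemma Lp_norm_weighted:
  assumes "0 < q" "\<And>x. 0 \<le> u x"
  shows "Lp_norm q (\<lambda>x. (u x powr (1 / q)) *\<^sub>R g x) =
    (\<integral>\<^sup>+x. ennreal (u x * norm (g x) powr q) \<partial>lebesgue) epowr (1 / q)"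
  using assms by (simp add: Lp_norm_def powr_mult powr_powr)

lemma pitt_for_of_Lp_norm:
  assumes pq: "0 < p" "0 < q" and u: "\<And>x. 0 \<le> u x" and v: "\<And>x. 0 \<le> v x"
    and int: "integrable lebesgue (\<lambda>x. v x * norm (f x) powr p)"
    and le: "Lp_norm q (\<lambda>\<xi>. (u \<xi> powr (1 / q)) *\<^sub>R fourier f \<xi>)
          \<le> ennreal C * Lp_norm p (\<lambda>x. (v x powr (1 / p)) *\<^sub>R f x)"
  shows "pitt_for p q u v (max C 0 powr q) f"
proof -
  define I where "I = (LINT x|lebesgue. v x * norm (f x) powr p)"
  have I: "0 \<le> I" using v by (auto simp: I_def intro!: integral_nonneg_AE)
  have "Lp_norm p (\<lambda>x. (v x powr (1 / p)) *\<^sub>R f x) = ennreal (I powr (1 / p))"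
    using int v pq I by (simp add: Lp_norm_weighted nn_integral_eq_integral I_def[symmetric] epowr_ennreal)
  \<comment> \<open>\<open>ennreal\<close> sends a negative C to 0, so C may be replaced by
    \<open>max C 0\<close>.\<close>
  moreover have "ennreal C * ennreal (I powr (1 / p)) = ennreal (max C 0 * I powr (1 / p))"
    by (simp add: ennreal_mult' max_def ennreal_neg)
  ultimately have "(\<integral>\<^sup>+\<xi>. ennreal (u \<xi> * norm (fourier f \<xi>) powr q) \<partial>lebesgue) epowr (1 / q)
      \<le> ennreal (max C 0 * I powr (1 / p))"
    using le by (simp only: Lp_norm_weighted[OF pq(2) u])
  from epowr_le_imp_le[OF this] show ?thesis
    using pq I by (simp add: pitt_for_def epowr_ennreal powr_mult powr_powr I_def)
qed

lemma integrable_fourier_integrand: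
  assumes "integrable lebesgue f"
  shows "integrable lebesgue (\<lambda>x. exp (\<i> * complex_of_real (x \<bullet> \<xi>)) * f x)"
proof (rule Bochner_Integration.integrable_bound[OF assms])
  have "(\<lambda>x. exp (\<i> * complex_of_real (x \<bullet> \<xi>))) \<in> borel_measurable lebesgue"
    by (intro measurable_completion borel_measurable_continuous_onI) (auto intro!: continuous_intros)
  then show "(\<lambda>x. exp (\<i> * complex_of_real (x \<bullet> \<xi>)) * f x) \<in> borel_measurable lebesgue"
    using assms by (auto intro!: borel_measurable_times)
qed (auto simp: norm_mult)

lemma continuous_on_fourier:
  fixes f :: "'a::euclidean_space \<Rightarrow> complex"
  assumes "integrable lebesgue f" shows "continuous_on UNIV (fourier f)"
  unfolding continuous_on_sequentially
proof (intro allI ballI impI, elim conjE)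
  fix s :: "nat \<Rightarrow> 'a" and \<xi> assume s: "s \<longlonglongrightarrow> \<xi>"
  show "(fourier f \<circ> s) \<longlonglongrightarrow> fourier f \<xi>"
    unfolding o_def fourier_def
  proof (rule integral_dominated_convergence)
    show "integrable lebesgue (\<lambda>x. norm (f x))" using assms by simp
    show "AE x in lebesgue. (\<lambda>i. exp (\<i> * complex_of_real (x \<bullet> s i)) * f x)
        \<longlonglongrightarrow> exp (\<i> * complex_of_real (x \<bullet> \<xi>)) * f x"
      using s by (auto intro!: tendsto_intros)
    show "(\<lambda>x. exp (\<i> * complex_of_real (x \<bullet> \<xi>)) * f x) \<in> borel_measurable lebesgue" for \<xi>
      using integrable_fourier_integrand[OF assms] by (rule borel_measurable_integrable)
    then show "(\<lambda>x. exp (\<i> * complex_of_real (x \<bullet> s i)) * f x) \<in> borel_measurable lebesgue" for i .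
  qed (auto simp: norm_mult)
qed

lemma borel_measurable_fourier:
  "integrable lebesgue f \<Longrightarrow> fourier f \<in> borel_measurable lebesgue"
  by (rule measurable_completion) (simp add: borel_measurable_continuous_onI continuous_on_fourier)

lemma borel_measurable_weighted_powr:
  fixes f :: "'a \<Rightarrow> 'b::real_normed_vector" and w :: "'a \<Rightarrow> real"
  assumes "w \<in> borel_measurable M" "f \<in> borel_measurable M"
  shows "(\<lambda>x. w x * norm (f x) powr p) \<in> borel_measurable M"
proof -
  have n: "(\<lambda>x. norm (f x)) \<in> borel_measurable M" 
    by (rule measurable_compose[OF assms(2) borel_measurable_norm])
  show ?thesis by (rule borel_measurable_times[OF assms(1) powr_real_measurable[OF n borel_measurable_const]])
qed

text \<open>The majorant G gives pointwise convergence of the transforms and, through v G^p,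
  convergence of the right sides. On the frequency side nothing dominates u |F^|^q, but Fatou's
  inequality goes in the required direction.\<close>

lemma pitt_for_limit:
  fixes f :: "'a::euclidean_space \<Rightarrow> complex"
  assumes pq: "0 < p" "0 < q"
    and u: "u \<in> borel_measurable lebesgue" "\<And>x. 0 \<le> u x"
    and v: "v \<in> borel_measurable lebesgue" "\<And>x. 0 \<le> v x"
    and meas: "\<And>k. F k \<in> borel_measurable lebesgue" "f \<in> borel_measurable lebesgue"
    and G: "integrable lebesgue G" "integrable lebesgue (\<lambda>x. v x * G x powr p)"
    and bound: "\<And>k. AE x in lebesgue. norm (F k x) \<le> G x"
    and lim: "AE x in lebesgue. (\<lambda>k. F k x) \<longlonglongrightarrow> f x"
    and pitt: "\<And>k. pitt_for p q u v C (F k)"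
  shows "pitt_for p q u v C f"
proof -
  have intF: "integrable lebesgue (F k)" for k
    by (rule Bochner_Integration.integrable_bound[OF G(1) meas(1)])
       (use bound[of k] in \<open>eventually_elim, auto\<close>)
  have expm: "(\<lambda>x. exp (\<i> * complex_of_real (x \<bullet> \<xi>))) \<in> borel_measurable lebesgue" for \<xi> :: 'a
    by (intro measurable_completion borel_measurable_continuous_onI) (auto intro!: continuous_intros)
  have four: "(\<lambda>k. fourier (F k) \<xi>) \<longlonglongrightarrow> fourier f \<xi>" for \<xi>
    unfolding fourier_def
  proof (rule integral_dominated_convergence[OF _ _ G(1)])
    show "AE x in lebesgue. (\<lambda>k. exp (\<i> * complex_of_real (x \<bullet> \<xi>)) * F k x)
        \<longlonglongrightarrow> exp (\<i> * complex_of_real (x \<bullet> \<xi>)) * f x"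
      using lim by eventually_elim (rule tendsto_mult_left)
    show "AE x in lebesgue. norm (exp (\<i> * complex_of_real (x \<bullet> \<xi>)) * F k x) \<le> G x" for k
      using bound[of k] by eventually_elim (simp add: norm_mult)
  qed (intro borel_measurable_times expm meas)+
  have rhs: "(\<lambda>k. LINT x|lebesgue. v x * norm (F k x) powr p)
      \<longlonglongrightarrow> (LINT x|lebesgue. v x * norm (f x) powr p)"
  proof (rule integral_dominated_convergence[OF _ _ G(2)])
    show "AE x in lebesgue. (\<lambda>k. v x * norm (F k x) powr p) \<longlonglongrightarrow> v x * norm (f x) powr p"
      using lim
      by eventually_elim (intro tendsto_mult_left tendsto_powr2 tendsto_norm tendsto_const always_eventually; use pq in simp)
    show "AE x in lebesgue. norm (v x * norm (F k x) powr p) \<le> v x * G x powr p" for k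
      using bound[of k] by eventually_elim (use v pq in \<open>auto intro!: mult_left_mono powr_mono2 simp: abs_mult\<close>)
    show "(\<lambda>x. v x * norm (f x) powr p) \<in> borel_measurable lebesgue"
      by (rule borel_measurable_weighted_powr[OF v(1) meas(2)])
    show "(\<lambda>x. v x * norm (F k x) powr p) \<in> borel_measurable lebesgue" for k
      by (rule borel_measurable_weighted_powr[OF v(1) meas(1)])
  qed
  have "(\<integral>\<^sup>+\<xi>. ennreal (u \<xi> * norm (fourier f \<xi>) powr q) \<partial>lebesgue)
      = (\<integral>\<^sup>+\<xi>. liminf (\<lambda>k. ennreal (u \<xi> * norm (fourier (F k) \<xi>) powr q)) \<partial>lebesgue)"
  proof (rule nn_integral_cong, rule sym, rule lim_imp_Liminf)
    show "(\<lambda>k. ennreal (u \<xi> * norm (fourier (F k) \<xi>) powr q))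
        \<longlonglongrightarrow> ennreal (u \<xi> * norm (fourier f \<xi>) powr q)" for \<xi>
      using pq by (intro tendsto_ennrealI tendsto_mult_left tendsto_powr2 tendsto_norm tendsto_const four
          always_eventually) auto
  qed simp
  also have "\<dots> \<le> liminf (\<lambda>k. \<integral>\<^sup>+\<xi>. ennreal (u \<xi> * norm (fourier (F k) \<xi>) powr q) \<partial>lebesgue)"
    by (intro nn_integral_liminf measurable_compose[OF borel_measurable_weighted_powr[OF u(1)
        borel_measurable_fourier[OF intF]] measurable_ennreal])
  also have "\<dots> \<le> liminf (\<lambda>k. ennreal (C * (LINT x|lebesgue. v x * norm (F k x) powr p) powr (q / p)))"
    using pitt by (intro Liminf_mono) (simp add: pitt_for_def)
  also have "\<dots> = ennreal (C * (LINT x|lebesgue. v x * norm (f x) powr p) powr (q / p))"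
  proof (rule lim_imp_Liminf)
    show "(\<lambda>k. ennreal (C * (LINT x|lebesgue. v x * norm (F k x) powr p) powr (q / p)))
        \<longlonglongrightarrow> ennreal (C * (LINT x|lebesgue. v x * norm (f x) powr p) powr (q / p))"
      using pq v by (intro tendsto_ennrealI tendsto_mult_left tendsto_powr2 tendsto_const rhs always_eventually
          allI integral_nonneg_AE) auto
  qed simp
  finally show ?thesis by (simp add: pitt_for_def)
qed

text \<open>Approximating g almost everywhere by continuous functions and these by polynomials turns the
  product with a sum of bumps into a limit of test functions.\<close>

lemma pitt_for_bump_times_bounded:
  fixes g :: "'a::euclidean_space \<Rightarrow> complex" and a :: "nat \<Rightarrow> 'a" and r :: "nat \<Rightarrow> real"
  assumes pq: "0 < p" "0 < q"
    and u: "u \<in> borel_measurable lebesgue" "\<And>x. 0 \<le> u x"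
    and v: "v \<in> borel_measurable lebesgue" "\<And>x. 0 \<le> v x"
    and pitt: "\<And>f. f \<in> test_functions \<Longrightarrow> integrable lebesgue (\<lambda>x. v x * norm (f x) powr p)
      \<Longrightarrow> pitt_for p q u v C f"
    and r: "\<And>i. 0 < r i" "\<And>i. set_integrable lebesgue (ball (a i) (r i)) v"
    and g: "g \<in> borel_measurable lebesgue" "\<And>x. norm (g x) \<le> M"
  shows "pitt_for p q u v C (\<lambda>x. complex_of_real (\<Sum>i<m. ball_bump (a i) (r i) x) * g x)"
proof -
  define \<omega> where "\<omega> x = (\<Sum>i<m. ball_bump (a i) (r i) x)" for x
  define W where "W = (\<Union>i<m. ball (a i) (r i))"
  define K where "K = (\<Union>i<m. cball (a i) (r i))"
  have "0 \<le> M" using g(2)[of 0] norm_ge_zero order_trans by blast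
  have K: "compact K" "W \<subseteq> K" unfolding K_def W_def by (auto intro!: UN_mono ball_subset_cball)
  have "bounded W" "open W" using K by (auto intro: bounded_subset compact_imp_bounded simp: W_def)
  then have Wm: "W \<in> lmeasurable" by (rule lmeasurable_open)
  have \<omega>0: "\<omega> x = 0" if "x \<notin> W" for x
    unfolding \<omega>_def
  proof (rule sum.neutral, safe)
    fix i assume "i < m"
    then show "ball_bump (a i) (r i) x = 0"
      using that ball_bump_pos_iff[OF r(1), of "a i" i x] ball_bump_nonneg[of "a i" "r i" x]
      by (auto simp: W_def)
  qed
  have \<omega>: "0 \<le> \<omega> x" "\<omega> x \<le> real m" for x
    unfolding \<omega>_def using sum_mono[of "{..<m}" "\<lambda>i. ball_bump (a i) (r i) x" "\<lambda>_. 1"]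
    by (auto intro: sum_nonneg ball_bump_nonneg ball_bump_le_1)
  have \<omega>c: "continuous_on UNIV \<omega>"
    unfolding \<omega>_def[abs_def] by (intro continuous_intros continuous_on_ball_bump)
  have \<omega>m: "(\<lambda>x. complex_of_real (\<omega> x)) \<in> borel_measurable lebesgue"
    using \<omega>c by (intro measurable_completion) (auto intro!: borel_measurable_continuous_onI continuous_intros)
  have "g measurable_on UNIV" using g by (intro lebesgue_measurable_imp_measurable_on) auto
  then obtain N h where N: "negligible N" and h: "\<And>n. continuous_on UNIV (h n)"
      and hlim: "\<And>x. x \<notin> N \<Longrightarrow> (\<lambda>n. h n x) \<longlonglongrightarrow> g x"
    unfolding measurable_on_def by auto
  \<comment> \<open>The continuous approximants \<open>h n\<close> may be unbounded. Projecting onto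
    the disc of radius M bounds them uniformly and fixes the values of g.\<close>
  define cl :: "complex \<Rightarrow> complex" where "cl = closest_point (cball 0 M)"
  have clc: "continuous_on UNIV cl"
    unfolding cl_def using \<open>0 \<le> M\<close> by (intro continuous_on_closest_point) auto
  have clb: "norm (cl z) \<le> M" for z
    using closest_point_in_set[of "cball 0 M" z] \<open>0 \<le> M\<close> by (auto simp: cl_def)
  have clg: "cl (g x) = g x" for x
    using closest_point_self[of "g x" "cball 0 M"] g(2) by (simp add: cl_def)
  have "\<exists>P. polynomial_function P \<and> (\<forall>x\<in>K. norm (cl (h n x) - P x) < inverse (real (Suc n)))" for n
  proof (rule Stone_Weierstrass_polynomial_function[OF K(1)])
    show "continuous_on K (\<lambda>x. cl (h n x))"
      using continuous_on_compose2[OF clc h[of n]] continuous_on_subset by blast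
  qed simp
  then obtain P where P: "\<And>n. polynomial_function (P n)"
    "\<And>n x. x \<in> K \<Longrightarrow> norm (cl (h n x) - P n x) < inverse (real (Suc n))" by metis
  define F where "F n x = complex_of_real (\<omega> x) * P n x" for n x
  \<comment> \<open>The factor m bounds a sum of m bumps of height at most 1; M + 1 bounds
    \<open>P n\<close> on W, where it differs from a value of modulus at most M by less than
    1/(n+1).\<close>
  define G where "G x = (real m * (M + 1)) * indicator W x" for x
  have smooth: "smooth_elem (F n)" for n
    unfolding F_def[abs_def] \<omega>_def of_real_sum
    by (intro smooth_elem.mult smooth_elem_sum smooth_elem_ball_bump smooth_elem_polynomial_function P)
  have Fm: "F n \<in> borel_measurable lebesgue" for n
    unfolding F_def[abs_def]
    by (rule borel_measurable_times[OF \<omega>m measurable_completion])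
      (simp add: borel_measurable_continuous_onI continuous_on_polymonial_function[OF P(1)])
  have bound: "norm (F n x) \<le> G x" for n x
  proof (cases "x \<in> W")
    case True
    then have "norm (cl (h n x) - P n x) < inverse (real (Suc n))" using P K by auto
    also have "\<dots> \<le> 1" by (simp add: field_simps)
    finally have "norm (P n x) \<le> M + 1"
      using clb[of "h n x"] norm_triangle_sub[of "P n x" "cl (h n x)"] by (simp add: norm_minus_commute)
    then show ?thesis
      using \<omega>[of x] True by (simp add: F_def G_def norm_mult mult_mono)
  qed (simp add: F_def G_def \<omega>0)
  have GI: "integrable lebesgue G"
    unfolding G_def[abs_def] using Wm by (auto simp: fmeasurable_def)
  \<comment> \<open>W is a finite union of balls on which v is integrable; this is what makes the
    weighted majorant integrable.\<close>
  have "set_integrable lebesgue W v"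
    unfolding W_def by (rule set_integrable_UN) (use r in auto)
  then have "integrable lebesgue (\<lambda>x. (real m * (M + 1)) powr p * (indicator W x *\<^sub>R v x))"
    by (auto simp: set_integrable_def)
  also have "(\<lambda>x. (real m * (M + 1)) powr p * (indicator W x *\<^sub>R v x)) = (\<lambda>x. v x * G x powr p)"
    using pq by (auto simp: G_def fun_eq_iff split: split_indicator)
  finally have GvI: "integrable lebesgue (\<lambda>x. v x * G x powr p)" .
  have pittF: "pitt_for p q u v C (F n)" for n
  proof (rule pitt)
    have "closure {x. F n x \<noteq> 0} \<subseteq> K"
      using K \<omega>0 by (intro closure_minimal) (auto simp: F_def compact_imp_closed)
    then have "compact (closure {x. F n x \<noteq> 0})"
      using K(1) compact_Int_closed[OF K(1) closed_closure] by (metis inf.absorb2)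
    then show "F n \<in> test_functions"
      using smooth_elem_imp_C_infinity[OF smooth] by (simp add: test_functions_def)
    show "integrable lebesgue (\<lambda>x. v x * norm (F n x) powr p)"
    proof (rule Bochner_Integration.integrable_bound[OF GvI])
      show "AE x in lebesgue. norm (v x * norm (F n x) powr p) \<le> norm (v x * G x powr p)"
        using pq v bound by (auto simp: abs_mult intro!: mult_left_mono powr_mono2)
    qed (rule borel_measurable_weighted_powr[OF v(1) Fm])
  qed
  have "pitt_for p q u v C (\<lambda>x. complex_of_real (\<omega> x) * g x)"
  proof (rule pitt_for_limit[OF pq u v Fm _ GI GvI _ _ pittF])
    show "(\<lambda>x. complex_of_real (\<omega> x) * g x) \<in> borel_measurable lebesgue"
      by (intro borel_measurable_times \<omega>m g)
    have "(\<lambda>n. F n x) \<longlonglongrightarrow> complex_of_real (\<omega> x) * g x" if "x \<notin> N" for x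
    proof (cases "x \<in> W")
      case True
      have "(\<lambda>n. cl (h n x)) \<longlonglongrightarrow> cl (g x)"
        using hlim[OF that] clc by (intro continuous_on_tendsto_compose[of UNIV cl]) auto
      moreover have "(\<lambda>n. cl (h n x) - P n x) \<longlonglongrightarrow> 0"
        by (rule Lim_null_comparison[OF always_eventually LIMSEQ_inverse_real_of_nat])
          (use P(2) True K in \<open>auto intro: less_imp_le\<close>)
      ultimately have "(\<lambda>n. cl (h n x) - (cl (h n x) - P n x)) \<longlonglongrightarrow> cl (g x) - 0"
        by (rule tendsto_diff)
      then show ?thesis
        unfolding F_def by (intro tendsto_mult_left) (simp add: clg)
    qed (simp add: F_def \<omega>0)
    moreover have "AE x in lebesgue. x \<notin> N"
      using N by (intro AE_not_in) (simp add: negligible_iff_null_sets)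
    ultimately show "AE x in lebesgue. (\<lambda>n. F n x) \<longlonglongrightarrow> complex_of_real (\<omega> x) * g x"
      by (auto elim: eventually_mono)
  qed (use bound in auto)
  then show ?thesis by (simp add: \<omega>_def)
qed

text \<open>Lindelof extracts a countable subcover from the balls on which v is integrable. It is
  nonempty, since otherwise the whole space would be null, so it can be enumerated by all naturals,
  possibly with repetitions.\<close>

lemma ae_locally_integrable_countable_balls:
  fixes v :: "'a::euclidean_space \<Rightarrow> real"
  assumes "ae_locally_integrable v"
  obtains a :: "nat \<Rightarrow> 'a" and r :: "nat \<Rightarrow> real"
  where "\<And>i. 0 < r i" "\<And>i. set_integrable lebesgue (ball (a i) (r i)) v"
    "AE x in lebesgue. \<exists>i. x \<in> ball (a i) (r i)"
proof -
  define \<F> where "\<F> = {ball x r | x r. 0 < r \<and> set_integrable lebesgue (ball x r) v}"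
  have "\<And>S. S \<in> \<F> \<Longrightarrow> open S" by (auto simp: \<F>_def)
  then obtain \<G> where \<G>: "\<G> \<subseteq> \<F>" "countable \<G>" "\<Union>\<G> = \<Union>\<F>" using Lindelof by metis
  have ae: "AE x in lebesgue. x \<in> \<Union>\<G>"
    using assms unfolding ae_locally_integrable_def \<G>(3)
  proof eventually_elim
    case (elim x)
    then obtain r where "0 < r" "set_integrable lebesgue (ball x r) v" by blast
    then have "ball x r \<in> \<F>" "x \<in> ball x r" by (auto simp: \<F>_def)
    then show ?case by blast
  qed
  have "\<G> \<noteq> {}"
  proof
    assume "\<G> = {}"
    with ae have "AE x in (lebesgue :: 'a measure). False" by simp
    then have "(UNIV :: 'a set) \<in> null_sets lebesgue" by (simp add: completion.AE_iff_null_sets)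
    then show False by (simp add: null_sets_def)
  qed
  then have "from_nat_into \<G> i \<in> \<F>" for i
    by (rule subsetD[OF \<G>(1) from_nat_into])
  then have "\<exists>x r. from_nat_into \<G> i = ball x r \<and> 0 < r \<and> set_integrable lebesgue (ball x r) v" for i
    unfolding \<F>_def by blast
  then obtain a r where ar: "\<And>i. from_nat_into \<G> i = ball (a i) (r i)" "\<And>i. 0 < r i"
    "\<And>i. set_integrable lebesgue (ball (a i) (r i)) v" by metis
  show thesis
  proof
    show "AE x in lebesgue. \<exists>i. x \<in> ball (a i) (r i)"
      using ae
    proof eventually_elim
      case (elim x)
      then obtain S where "S \<in> \<G>" "x \<in> S" by auto
      then show ?case
        using ar(1) from_nat_into_surj[OF \<G>(2)] by metis
    qed
  qed (use ar in auto)
qed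

text \<open>Division fits an arbitrary f to the case of bumps times a bounded function: where f is
  bounded and the sum of bumps stays away from 0, f is that sum times a bounded quotient.\<close>

theorem pitt_inequality_extends:
  fixes u v :: "'a::euclidean_space \<Rightarrow> real"
  assumes pq: "0 < p" "0 < q"
    and u: "u \<in> borel_measurable lebesgue" "\<And>x. 0 \<le> u x"
    and v: "v \<in> borel_measurable lebesgue" "\<And>x. 0 \<le> v x" "ae_locally_integrable v"
    and pitt: "pitt_inequality p q u v"
  obtains C where "0 \<le> C"
    "\<And>f. integrable lebesgue f \<Longrightarrow> integrable lebesgue (\<lambda>x. v x * norm (f x) powr p)
       \<Longrightarrow> pitt_for p q u v C f"
proof -
  from pitt obtain C0 where C0: "\<And>f. f \<in> test_functions \<Longrightarrow>
     Lp_norm q (\<lambda>\<xi>. (u \<xi> powr (1 / q)) *\<^sub>R fourier f \<xi>)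
          \<le> ennreal C0 * Lp_norm p (\<lambda>x. (v x powr (1 / p)) *\<^sub>R f x)"
    unfolding pitt_inequality_def by blast
  define C where "C = max C0 0 powr q"
  have test: "pitt_for p q u v C f"
    if "f \<in> test_functions" "integrable lebesgue (\<lambda>x. v x * norm (f x) powr p)" for f
    unfolding C_def by (rule pitt_for_of_Lp_norm[OF pq u(2) v(2) that(2) C0[OF that(1)]])
  obtain a :: "nat \<Rightarrow> 'a" and r :: "nat \<Rightarrow> real"
    where r: "\<And>i. 0 < r i" "\<And>i. set_integrable lebesgue (ball (a i) (r i)) v"
      and cover: "AE x in lebesgue. \<exists>i. x \<in> ball (a i) (r i)"
    by (rule ae_locally_integrable_countable_balls[OF v(3)]) (rule that)
  define \<omega> where "\<omega> m x = (\<Sum>i<m. ball_bump (a i) (r i) x)" for m x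
  have [measurable]: "\<omega> m \<in> borel_measurable lebesgue" for m
    unfolding \<omega>_def[abs_def]
    by (intro measurable_completion) (auto intro!: borel_measurable_continuous_onI continuous_intros continuous_on_ball_bump)
  show thesis
  proof (rule that)
    show "0 \<le> C" by (simp add: C_def)
    fix f :: "'a \<Rightarrow> complex"
    assume f: "integrable lebesgue f" "integrable lebesgue (\<lambda>x. v x * norm (f x) powr p)"
    have fm[measurable]: "f \<in> borel_measurable lebesgue" using f by auto
    \<comment> \<open>The two conditions make |f| / \<open>\<omega> k\<close> at most k (k + 1) on
      \<open>E k\<close>.\<close>
    define E where "E k = {x. norm (f x) \<le> real k \<and> inverse (real (Suc k)) \<le> \<omega> k x}" for k
    have E[measurable]: "E k \<in> sets lebesgue" for k
    proof -
      have "{x \<in> space lebesgue. norm (f x) \<le> real k \<and> inverse (real (Suc k)) \<le> \<omega> k x} \<in> sets lebesgue"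
        by measurable
      then show ?thesis by (simp add: E_def)
    qed
    define F where "F k x = (if x \<in> E k then f x else 0)" for k x
    have Fm: "F k \<in> borel_measurable lebesgue" for k
      unfolding F_def[abs_def] by measurable
    have pF: "pitt_for p q u v C (F k)" for k
    proof -
      define g where "g x = (if x \<in> E k then f x / complex_of_real (\<omega> k x) else 0)" for x
      have gm: "g \<in> borel_measurable lebesgue" unfolding g_def[abs_def] by measurable
      have gb: "norm (g x) \<le> real k * real (Suc k)" for x
      proof (cases "x \<in> E k")
        case True
        then have *: "norm (f x) \<le> real k" "inverse (real (Suc k)) \<le> \<omega> k x" by (auto simp: E_def)
        have "0 < inverse (real (Suc k))" by simp
        with *(2) have "0 < \<omega> k x" by (rule less_le_trans[rotated])
        moreover have "inverse (\<omega> k x) \<le> real (Suc k)"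
          using le_imp_inverse_le[OF *(2)] by simp
        ultimately show ?thesis
          using * True mult_mono[of "norm (f x)" "real k" "inverse (\<omega> k x)" "real (Suc k)"]
          by (simp add: g_def norm_divide divide_inverse norm_mult norm_inverse)
      qed (simp add: g_def)
      have "F k = (\<lambda>x. complex_of_real (\<Sum>i<k. ball_bump (a i) (r i) x) * g x)"
      proof
        fix x
        have "\<omega> k x \<noteq> 0" if "x \<in> E k"
        proof -
          have "0 < inverse (real (Suc k))" by simp
          then show ?thesis using that by (auto simp: E_def simp del: of_nat_Suc)
        qed
        then show "F k x = complex_of_real (\<Sum>i<k. ball_bump (a i) (r i) x) * g x"
          unfolding \<omega>_def[symmetric] by (simp add: F_def g_def)
      qed
      then show ?thesis
        using pitt_for_bump_times_bounded[OF pq u v(1,2) test r gm gb, where m=k] by simp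
    qed
    show "pitt_for p q u v C f"
    proof (rule pitt_for_limit[OF pq u v(1,2) Fm fm _ _ _ _ pF])
      show "integrable lebesgue (\<lambda>x. norm (f x))" using f by simp
      show "integrable lebesgue (\<lambda>x. v x * norm (f x) powr p)" by fact
      show "AE x in lebesgue. norm (F k x) \<le> norm (f x)" for k by (simp add: F_def)
      show "AE x in lebesgue. (\<lambda>k. F k x) \<longlonglongrightarrow> f x"
        using cover
      proof eventually_elim
        case (elim x)
        then obtain i where i: "x \<in> ball (a i) (r i)" by auto
        \<comment> \<open>The i-th bump alone keeps \<open>\<omega> k x\<close> at or above \<delta>
          for every k > i, while 1/(k+1) eventually drops below it. So x lies in \<open>E k\<close>
          for all large k.\<close>
        define \<delta> where "\<delta> = ball_bump (a i) (r i) x"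
        have "0 < \<delta>" using i ball_bump_pos_iff[OF r(1)[of i], of "a i" x] by (simp add: \<delta>_def)
        then obtain k0 where k0: "inverse (real (Suc k0)) < \<delta>" using reals_Archimedean by blast
        obtain k1 where k1: "norm (f x) \<le> real k1" using real_arch_simple by blast
        have "F k x = f x" if "k \<ge> max (Suc i) (max k0 k1)" for k
        proof -
          have "\<delta> \<le> \<omega> k x"
            unfolding \<delta>_def \<omega>_def by (rule member_le_sum) (use that in \<open>auto simp: ball_bump_nonneg\<close>)
          moreover have "inverse (real (Suc k)) \<le> inverse (real (Suc k0))"
            using that by (intro le_imp_inverse_le) auto
          ultimately have "inverse (real (Suc k)) \<le> \<omega> k x" using k0 by linarith
          moreover have "norm (f x) \<le> real k" using k1 that by simp
          ultimately have "x \<in> E k" by (simp add: E_def del: of_nat_Suc)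
          then show ?thesis by (simp add: F_def)
        qed
        then show ?case
          by (intro tendsto_eventually)
            (auto simp: eventually_sequentially intro!: exI[of _ "max (Suc i) (max k0 k1)"])
      qed
    qed
  qed
qed

section \<open>Weight products from lower bounds of the Fourier transform\<close>

text \<open>The truncation at height n of the function \<open>v\<^bsup>1-p'\<^esup>\<close> on A, which is extremal for the duality
  between \<open>L\<^sup>p(v)\<close> and its dual; where v vanishes it takes the value n.\<close>

definition trunc_dual :: "real \<Rightarrow> ('a::euclidean_space \<Rightarrow> real) \<Rightarrow> 'a set \<Rightarrow> nat \<Rightarrow> 'a \<Rightarrow> real" where
  "trunc_dual p v A n x = indicator A x * enn2real (min (ennreal (v x) epowr (1 - conj_exponent p)) (of_nat n))"

lemma trunc_dual_nonneg: "0 \<le> trunc_dual p v A n x"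
  by (simp add: trunc_dual_def)

lemma ennreal_trunc_dual:
  "ennreal (trunc_dual p v A n x)
    = indicator A x * min (ennreal (v x) epowr (1 - conj_exponent p)) (of_nat n)"
proof -
  have "min (ennreal (v x) epowr (1 - conj_exponent p)) (of_nat n) < top"
    by (simp add: min_less_iff_disj of_nat_less_top)
  then show ?thesis by (simp add: trunc_dual_def indicator_def)
qed

lemma trunc_dual_le: "trunc_dual p v A n x \<le> real n * indicator A x"
proof -
  have "ennreal (trunc_dual p v A n x) \<le> ennreal (real n * indicator A x)"
    unfolding ennreal_trunc_dual by (auto simp: indicator_def ennreal_of_nat_eq_real_of_nat)
  then show ?thesis by (subst (asm) ennreal_le_iff) auto
qed

lemma borel_measurable_epowr:
  assumes "f \<in> borel_measurable M" shows "(\<lambda>x. f x epowr r) \<in> borel_measurable M"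
proof -
  have "(\<lambda>y. y epowr r) \<in> borel_measurable borel"
    unfolding ennpowr_def by measurable
  from measurable_compose[OF assms this] show ?thesis .
qed

lemma borel_measurable_trunc_dual:
  assumes "v \<in> borel_measurable lebesgue" "A \<in> sets lebesgue"
  shows "trunc_dual p v A n \<in> borel_measurable lebesgue"
proof -
  have "(\<lambda>x. ennreal (v x) epowr (1 - conj_exponent p)) \<in> borel_measurable lebesgue"
    by (intro borel_measurable_epowr measurable_compose[OF assms(1) measurable_ennreal])
  then have "(\<lambda>x. min (ennreal (v x) epowr (1 - conj_exponent p)) (of_nat n)) \<in> borel_measurable lebesgue"
    by (rule borel_measurable_min[OF borel_measurable_const])
  then have "(\<lambda>x. enn2real (min (ennreal (v x) epowr (1 - conj_exponent p)) (of_nat n))) \<in> borel_measurable lebesgue"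
    by (rule borel_measurable_enn2real)
  then show ?thesis
    unfolding trunc_dual_def[abs_def]
    by (intro borel_measurable_times borel_measurable_indicator assms)
qed

lemma integrable_trunc_dual:
  assumes "v \<in> borel_measurable lebesgue" "A \<in> lmeasurable"
  shows "integrable lebesgue (trunc_dual p v A n)"
proof (rule Bochner_Integration.integrable_bound)
  show "integrable lebesgue (\<lambda>x. real n * indicator A x)" using assms by (auto simp: fmeasurable_def)
  show "trunc_dual p v A n \<in> borel_measurable lebesgue"
    by (rule borel_measurable_trunc_dual) (use assms in auto)
  show "AE x in lebesgue. norm (trunc_dual p v A n x) \<le> norm (real n * indicator A x)"
    using trunc_dual_le[of p v A n] trunc_dual_nonneg[of p v A n] by (auto simp: abs_of_nonneg)
qed

text \<open>Since (1 - p')(p - 1) = -1, the cap t <= v^(1-p') gives v t^(p-1) <= 1 where v and t are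
  positive; multiply by t. Where v vanishes the left side is 0, whatever the truncated
  value.\<close>

lemma weight_times_trunc_dual_powr_le:
  assumes "1 < p" "0 \<le> v x"
  shows "v x * trunc_dual p v A n x powr p \<le> trunc_dual p v A n x"
proof (cases "v x = 0 \<or> trunc_dual p v A n x = 0")
  case False
  define t where "t = trunc_dual p v A n x"
  have t: "0 < t" "x \<in> A" using False trunc_dual_nonneg[of p v A n x]
    by (auto simp: t_def) (auto simp: trunc_dual_def indicator_def split: if_splits)
  have v: "0 < v x" using False assms by auto
  have e: "1 - conj_exponent p = - 1 / (p - 1)" using assms by (simp add: conj_exponent_def field_simps)
  have "ennreal t \<le> ennreal (v x) epowr (1 - conj_exponent p)"
    using t unfolding t_def ennreal_trunc_dual by (simp add: indicator_def)
  also have "\<dots> = ennreal (v x powr (- 1 / (p - 1)))"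
    using v assms unfolding e by (simp add: ennpowr_def)
  finally have "t \<le> v x powr (- 1 / (p - 1))" by (subst (asm) ennreal_le_iff) auto
  then have "t powr (p - 1) \<le> (v x powr (- 1 / (p - 1))) powr (p - 1)"
    using t assms by (intro powr_mono2) auto
  also have "\<dots> = inverse (v x)"
    using assms v powr_powr[of "v x" "- 1 / (p - 1)" "p - 1"] by (simp add: powr_minus del: powr_powr)
  finally have "v x * t powr (p - 1) \<le> 1" using v by (simp add: field_simps)
  then have "(v x * t powr (p - 1)) * t \<le> 1 * t" using t by (intro mult_right_mono) auto
  moreover have "t powr (p - 1) * t = t powr p"
    using powr_add[of t "p - 1" 1] t by simp
  ultimately show ?thesis by (simp add: t_def mult.assoc)
qed (use trunc_dual_nonneg in auto)

text \<open>The unimodular factor e leaves the weighted norm unchanged and lets B be centred away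
  from the origin. One function has to serve all frequencies in B at once, so e is fixed before
  \<xi> and n.\<close>

theorem weight_product_le:
  fixes u v :: "'a::euclidean_space \<Rightarrow> real"
  assumes pq: "1 < p" "1 < q"
    and u: "u \<in> borel_measurable lebesgue" "\<And>x. 0 \<le> u x"
    and v: "v \<in> borel_measurable lebesgue" "\<And>x. 0 \<le> v x"
    and C: "0 \<le> C" "\<And>f. integrable lebesgue f \<Longrightarrow> integrable lebesgue (\<lambda>x. v x * norm (f x) powr p)
       \<Longrightarrow> pitt_for p q u v C f"
    and AB: "A \<in> lmeasurable" "B \<in> sets lebesgue"
    and e: "e \<in> borel_measurable lebesgue" "\<And>x. norm (e x) = 1"
    and \<kappa>: "0 < \<kappa>"
    and lower: "\<And>n \<xi>. \<xi> \<in> B \<Longrightarrow> \<kappa> * (LINT x|lebesgue. trunc_dual p v A n x)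
        \<le> norm (fourier (\<lambda>x. e x * complex_of_real (trunc_dual p v A n x)) \<xi>)"
  shows "weight_product p q u v B A \<le> ennreal (C powr (1 / q) / \<kappa>)"
proof -
  define a where "a = (\<integral>\<^sup>+\<xi>\<in>B. ennreal (u \<xi>) \<partial>lebesgue)"
  define I where "I n = (LINT x|lebesgue. trunc_dual p v A n x)" for n
  have A: "A \<in> sets lebesgue" using AB by auto
  have wt: "v x * trunc_dual p v A n x powr p \<le> trunc_dual p v A n x" for x n
    using pq(1) v(2) by (rule weight_times_trunc_dual_powr_le)
  have hm: "trunc_dual p v A n \<in> borel_measurable lebesgue" for n
    by (rule borel_measurable_trunc_dual[OF v(1) A])
  have hi: "integrable lebesgue (trunc_dual p v A n)" for n
    by (rule integrable_trunc_dual[OF v(1) AB(1)])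
  have I0: "0 \<le> I n" for n by (auto simp: I_def trunc_dual_nonneg intro!: integral_nonneg_AE)
  have p': "1 / conj_exponent p = 1 - 1 / p" "0 < 1 - 1 / p" using pq by (auto simp: conj_exponent_def field_simps)
  have key: "a epowr (1 / q) * ennreal (I n) epowr (1 / conj_exponent p) \<le> ennreal (C powr (1 / q) / \<kappa>)" for n
  proof (cases "I n = 0")
    case True
    then show ?thesis using p' by (simp add: epowr_zero)
  next
    case False
    then have In: "0 < I n" using I0[of n] by simp
    define f where "f x = e x * complex_of_real (trunc_dual p v A n x)" for x
    have nf: "norm (f x) = trunc_dual p v A n x" for x
      by (simp add: f_def norm_mult e trunc_dual_nonneg)
    have fm: "f \<in> borel_measurable lebesgue"
      unfolding f_def[abs_def]
      by (intro borel_measurable_times e measurable_compose[OF hm borel_measurable_of_real])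
    have fi: "integrable lebesgue f"
      by (rule Bochner_Integration.integrable_bound[OF hi[of n] fm]) (simp add: nf trunc_dual_nonneg)
    have fvi: "integrable lebesgue (\<lambda>x. v x * norm (f x) powr p)"
    proof (rule Bochner_Integration.integrable_bound[OF hi[of n] borel_measurable_weighted_powr[OF v(1) fm]])
      show "AE x in lebesgue. norm (v x * norm (f x) powr p) \<le> norm (trunc_dual p v A n x)"
        using wt[of _ n] v(2) trunc_dual_nonneg[of p v A n]
        by (simp add: nf)
    qed
    have le: "(LINT x|lebesgue. v x * norm (f x) powr p) \<le> I n"
      unfolding I_def by (rule integral_mono[OF fvi hi])
        (use wt[of _ n] in \<open>simp add: nf\<close>)
    have "a * ennreal ((\<kappa> * I n) powr q) = (\<integral>\<^sup>+\<xi>. ennreal (u \<xi>) * indicator B \<xi> * ennreal ((\<kappa> * I n) powr q) \<partial>lebesgue)"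
      unfolding a_def by (rule nn_integral_multc[symmetric])
        (intro borel_measurable_times_ennreal measurable_compose[OF u(1) measurable_ennreal] borel_measurable_indicator AB)
    also have "\<dots> \<le> (\<integral>\<^sup>+\<xi>. ennreal (u \<xi> * norm (fourier f \<xi>) powr q) \<partial>lebesgue)"
    proof (rule nn_integral_mono)
      fix \<xi>
      have "(\<kappa> * I n) powr q \<le> norm (fourier f \<xi>) powr q" if "\<xi> \<in> B"
        using lower[OF that, of n] \<kappa> I0[of n] pq unfolding f_def[abs_def] I_def[symmetric]
        by (intro powr_mono2) auto
      then show "ennreal (u \<xi>) * indicator B \<xi> * ennreal ((\<kappa> * I n) powr q)
          \<le> ennreal (u \<xi> * norm (fourier f \<xi>) powr q)"
        using u(2)[of \<xi>] by (auto simp: indicator_def ennreal_mult'[symmetric] intro!: ennreal_leI mult_left_mono)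
    qed
    also have "\<dots> \<le> ennreal (C * (LINT x|lebesgue. v x * norm (f x) powr p) powr (q / p))"
      using C(2)[OF fi fvi] by (simp add: pitt_for_def)
    also have "\<dots> \<le> ennreal (C * I n powr (q / p))"
      using le C(1) pq v(2) by (intro ennreal_leI mult_left_mono powr_mono2) (auto intro!: integral_nonneg_AE)
    finally have *: "a * ennreal ((\<kappa> * I n) powr q) \<le> ennreal (C * I n powr (q / p))" .
    have pos: "0 < (\<kappa> * I n) powr q" using \<kappa> In by simp
    \<comment> \<open>As \<open>I n\<close> is positive, an infinite mass of u on B would contradict
      the finite right side.\<close>
    have "a \<noteq> top"
    proof
      assume "a = top"
      with * pos have "top \<le> ennreal (C * I n powr (q / p))" by (simp add: ennreal_top_mult)
      then show False by (simp add: top_unique)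
    qed
    then obtain b where b: "a = ennreal b" "0 \<le> b" by (cases a) auto
    with * have "b * (\<kappa> * I n) powr q \<le> C * I n powr (q / p)"
      using C(1) by (simp add: ennreal_mult'[symmetric])
    then have "(b * (\<kappa> * I n) powr q) powr (1 / q) \<le> (C * I n powr (q / p)) powr (1 / q)"
      using b pq by (intro powr_mono2) auto
    then have "b powr (1 / q) * (\<kappa> * I n) \<le> C powr (1 / q) * I n powr (1 / p)"
      using b C(1) \<kappa> In pq by (simp add: powr_mult powr_powr)
    \<comment> \<open>The factor \<open>I n powr (1 / p)\<close> cancels against the right side; the
      remaining exponent 1 - 1/p = 1/p' is the one in \<open>weight_product\<close>.\<close>
    moreover have "I n = I n powr (1 - 1 / p) * I n powr (1 / p)"
      using In powr_add[of "I n" "1 - 1 / p" "1 / p"] by simp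
    ultimately have "(b powr (1 / q) * I n powr (1 - 1 / p) * \<kappa>) * I n powr (1 / p) \<le> C powr (1 / q) * I n powr (1 / p)"
      by (metis mult.assoc mult.commute)
    then have "b powr (1 / q) * I n powr (1 - 1 / p) * \<kappa> \<le> C powr (1 / q)"
      using In by (subst (asm) mult_le_cancel_right_pos) auto
    then have "b powr (1 / q) * I n powr (1 - 1 / p) \<le> C powr (1 / q) / \<kappa>"
      using \<kappa> by (simp add: pos_le_divide_eq)
    then show ?thesis
      using b In pq p' by (simp add: epowr_ennreal ennreal_mult'[symmetric] ennreal_leI)
  qed
  \<comment> \<open>The bound in \<open>key\<close> is uniform in n, so monotone convergence in the
    truncation height recovers the untruncated integral.\<close>
  have "(\<integral>\<^sup>+x\<in>A. ennreal (v x) epowr (1 - conj_exponent p) \<partial>lebesgue)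
      = (\<integral>\<^sup>+x. (SUP n. ennreal (trunc_dual p v A n x)) \<partial>lebesgue)"
  proof (rule nn_integral_cong)
    fix x
    define s where "s = ennreal (v x) epowr (1 - conj_exponent p)"
    have "(SUP n. min s (of_nat n)) = min s (SUP n. of_nat n)"
      using inf_SUP[of s "\<lambda>n. of_nat n :: ennreal" UNIV] by (simp add: inf_min)
    then have "(SUP n. min s (of_nat n)) = s" by (simp add: ennreal_SUP_of_nat_eq_top)
    then show "s * indicator A x = (SUP n. ennreal (trunc_dual p v A n x))"
      unfolding ennreal_trunc_dual s_def[symmetric] by (simp add: indicator_def)
  qed
  also have "\<dots> = (SUP n. \<integral>\<^sup>+x. ennreal (trunc_dual p v A n x) \<partial>lebesgue)"
  proof (rule nn_integral_monotone_convergence_SUP)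
    show "incseq (\<lambda>n x. ennreal (trunc_dual p v A n x))"
      unfolding ennreal_trunc_dual incseq_def le_fun_def
      by (intro allI impI mult_left_mono min.mono) auto
  qed (rule measurable_compose[OF hm measurable_ennreal])
  also have "\<dots> = (SUP n. ennreal (I n))"
    unfolding I_def using hi by (intro SUP_cong refl nn_integral_eq_integral) (auto simp: trunc_dual_nonneg)
  finally have b: "(\<integral>\<^sup>+x\<in>A. ennreal (v x) epowr (1 - conj_exponent p) \<partial>lebesgue) = (SUP n. ennreal (I n))" .
  have "weight_product p q u v B A = (SUP n. a epowr (1 / q) * ennreal (I n) epowr (1 / conj_exponent p))"
    unfolding weight_product_def b a_def[symmetric] using p' by (simp add: epowr_SUP SUP_mult_left_ennreal)
  also have "\<dots> \<le> ennreal (C powr (1 / q) / \<kappa>)"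
    by (rule SUP_least) (rule key)
  finally show ?thesis .
qed

section \<open>Translates of a body and of its scaled polar\<close>

lemma closed_polar: "closed (polar A)"
proof -
  have "polar A = (\<Inter>x\<in>A. {\<xi>. \<bar>x \<bullet> \<xi>\<bar> \<le> 1})" by (auto simp: polar_def)
  also have "closed \<dots>" by (intro closed_INT ballI closed_Collect_le continuous_intros)
  finally show ?thesis .
qed

text \<open>The modulation moves the frequency centre \<eta> to 0, and the spatial centre y only
  costs a constant phase. Both centres are arbitrary and independent, so that any piece of one union
  can be paired with any piece of the other.\<close>

lemma weight_product_translates_le:
  fixes u v :: "'a::euclidean_space \<Rightarrow> real"
  assumes pq: "1 < p" "1 < q"
    and u: "u \<in> borel_measurable lebesgue" "\<And>x. 0 \<le> u x"
    and v: "v \<in> borel_measurable lebesgue" "\<And>x. 0 \<le> v x"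
    and C: "0 \<le> C" "\<And>f. integrable lebesgue f \<Longrightarrow> integrable lebesgue (\<lambda>x. v x * norm (f x) powr p)
       \<Longrightarrow> pitt_for p q u v C f"
    and A: "compact A" and c: "0 < c" "c < pi / 2"
  shows "weight_product p q u v ((+) \<eta> ` (*\<^sub>R) c ` polar A) ((+) y ` A) \<le> ennreal (C powr (1 / q) / cos c)"
proof -
  define e :: "'a \<Rightarrow> complex" where "e x = exp (\<i> * complex_of_real (- (x \<bullet> \<eta>)))" for x
  have "compact ((+) y ` A)" using A by (rule compact_translation)
  then have Am: "(+) y ` A \<in> lmeasurable" by (rule lmeasurable_compact)
  have "closed ((+) \<eta> ` (*\<^sub>R) c ` polar A)" by (intro closed_translation closed_scaling closed_polar)
  then have Bm: "(+) \<eta> ` (*\<^sub>R) c ` polar A \<in> sets lebesgue" by auto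
  have em: "e \<in> borel_measurable lebesgue"
    unfolding e_def[abs_def]
    by (intro measurable_completion borel_measurable_continuous_onI) (auto intro!: continuous_intros)
  have en: "norm (e x) = 1" for x
    unfolding e_def using norm_exp_i_times by blast
  have cos: "0 < cos c" using c by (intro cos_gt_zero_pi) auto
  show ?thesis
  proof (rule weight_product_le[OF pq u v C Am Bm em en cos])
    fix n \<xi> assume "\<xi> \<in> (+) \<eta> ` (*\<^sub>R) c ` polar A"
    then obtain \<zeta> where \<zeta>: "\<zeta> \<in> polar A" "\<xi> = \<eta> + c *\<^sub>R \<zeta>" by auto
    define h where "h = trunc_dual p v ((+) y ` A) n"
    have hm: "h \<in> borel_measurable lebesgue"
      unfolding h_def by (rule borel_measurable_trunc_dual[OF v(1)]) (use Am in auto)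
    have hi: "integrable lebesgue h"
      unfolding h_def by (rule integrable_trunc_dual[OF v(1) Am])
    \<comment> \<open>Unlike e, this phase depends on the frequency. It is constant in x, however,
      so it leaves the modulus of the integral unchanged.\<close>
    define w where "w = exp (\<i> * complex_of_real (- (y \<bullet> (c *\<^sub>R \<zeta>))))"
    have fi: "integrable lebesgue (\<lambda>x. exp (\<i> * complex_of_real ((x - y) \<bullet> (c *\<^sub>R \<zeta>))) * complex_of_real (h x))"
    proof (rule Bochner_Integration.integrable_bound[OF hi])
      show "(\<lambda>x. exp (\<i> * complex_of_real ((x - y) \<bullet> (c *\<^sub>R \<zeta>))) * complex_of_real (h x)) \<in> borel_measurable lebesgue"
        by (intro borel_measurable_times measurable_compose[OF hm borel_measurable_of_real]
            measurable_completion borel_measurable_continuous_onI) (auto intro!: continuous_intros)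
    qed (auto simp: norm_mult)
    have "cos c * (LINT x|lebesgue. h x) = (LINT x|lebesgue. cos c * h x)"
      by simp
    also have "\<dots> \<le> (LINT x|lebesgue. Re (exp (\<i> * complex_of_real ((x - y) \<bullet> (c *\<^sub>R \<zeta>))) * complex_of_real (h x)))"
    proof (rule integral_mono)
      show "integrable lebesgue (\<lambda>x. cos c * h x)" using hi by simp
      show "integrable lebesgue (\<lambda>x. Re (exp (\<i> * complex_of_real ((x - y) \<bullet> (c *\<^sub>R \<zeta>))) * complex_of_real (h x)))"
        using integrable_Re[OF fi] .
      fix x :: 'a
      show "cos c * h x \<le> Re (exp (\<i> * complex_of_real ((x - y) \<bullet> (c *\<^sub>R \<zeta>))) * complex_of_real (h x))"
      proof (cases "x \<in> (+) y ` A")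
        case True
        then have "\<bar>(x - y) \<bullet> \<zeta>\<bar> \<le> 1" using \<zeta>(1) by (auto simp: polar_def)
        then have "\<bar>(x - y) \<bullet> (c *\<^sub>R \<zeta>)\<bar> \<le> c"
          using c mult_left_mono[of "\<bar>(x - y) \<bullet> \<zeta>\<bar>" 1 c] by (simp add: abs_mult)
        then have "cos c \<le> cos \<bar>(x - y) \<bullet> (c *\<^sub>R \<zeta>)\<bar>"
          using c by (intro cos_monotone_0_pi_le) auto
        then have "cos c * h x \<le> cos ((x - y) \<bullet> (c *\<^sub>R \<zeta>)) * h x"
          using trunc_dual_nonneg by (intro mult_right_mono) (auto simp: h_def)
        then show ?thesis by (simp add: exp_eq_polar Re_exp)
      qed (simp add: h_def trunc_dual_def)
    qed
    also have "\<dots> = Re (LINT x|lebesgue. exp (\<i> * complex_of_real ((x - y) \<bullet> (c *\<^sub>R \<zeta>))) * complex_of_real (h x))"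
      by (rule integral_Re[OF fi])
    also have "\<dots> \<le> norm (LINT x|lebesgue. exp (\<i> * complex_of_real ((x - y) \<bullet> (c *\<^sub>R \<zeta>))) * complex_of_real (h x))"
      by (rule complex_Re_le_cmod)
    also have "(\<lambda>x. exp (\<i> * complex_of_real ((x - y) \<bullet> (c *\<^sub>R \<zeta>))) * complex_of_real (h x))
        = (\<lambda>x. w * (exp (\<i> * complex_of_real (x \<bullet> \<xi>)) * (e x * complex_of_real (h x))))"
    proof
      fix x
      have "exp (\<i> * complex_of_real ((x - y) \<bullet> (c *\<^sub>R \<zeta>)))
          = w * (exp (\<i> * complex_of_real (x \<bullet> \<xi>)) * e x)"
        unfolding w_def e_def \<zeta>(2) mult_exp_exp
        by (rule arg_cong[where f=exp]) (simp add: algebra_simps inner_diff_left inner_add_right)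
      then show "exp (\<i> * complex_of_real ((x - y) \<bullet> (c *\<^sub>R \<zeta>))) * complex_of_real (h x)
          = w * (exp (\<i> * complex_of_real (x \<bullet> \<xi>)) * (e x * complex_of_real (h x)))"
        by (simp only: mult.assoc)
    qed
    also have "norm (LINT x|lebesgue. w * (exp (\<i> * complex_of_real (x \<bullet> \<xi>)) * (e x * complex_of_real (h x))))
        = norm w * norm (fourier (\<lambda>x. e x * complex_of_real (h x)) \<xi>)"
      by (simp add: fourier_def norm_mult)
    also have "norm w = 1" unfolding w_def using norm_exp_i_times by blast
    finally show "cos c * (LINT x|lebesgue. trunc_dual p v ((+) y ` A) n x)
        \<le> norm (fourier (\<lambda>x. e x * complex_of_real (trunc_dual p v ((+) y ` A) n x)) \<xi>)"
      by (simp add: h_def)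
  qed
qed

section \<open>Finite unions of sets\<close>

lemma epowr_cmult:
  assumes "0 \<le> c" "0 < r"
  shows "(ennreal c * x) epowr r = ennreal (c powr r) * x epowr r"
proof (cases x)
  case (real a)
  then show ?thesis
    using assms by (simp add: epowr_ennreal ennreal_mult'[symmetric] powr_mult)
next
  case top
  then show ?thesis
    using assms by (cases "c = 0") (auto simp: epowr_top epowr_zero ennreal_mult_top)
qed

lemma nn_integral_UN_le_card_mult_Max:
  assumes "finite J" "J \<noteq> {}" "w \<in> borel_measurable M" "\<And>j. j \<in> J \<Longrightarrow> S j \<in> sets M"
  shows "(\<integral>\<^sup>+x\<in>(\<Union>j\<in>J. S j). w x \<partial>M) \<le> ennreal (real (card J)) * (MAX j\<in>J. \<integral>\<^sup>+x\<in>S j. w x \<partial>M)"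
proof -
  have "(\<integral>\<^sup>+x\<in>(\<Union>j\<in>J. S j). w x \<partial>M) \<le> (\<integral>\<^sup>+x. (\<Sum>j\<in>J. w x * indicator (S j) x) \<partial>M)"
  proof (rule nn_integral_mono)
    fix x
    show "w x * indicator (\<Union>j\<in>J. S j) x \<le> (\<Sum>j\<in>J. w x * indicator (S j) x)"
    proof (cases "\<exists>j\<in>J. x \<in> S j")
      case True
      then obtain j where j: "j \<in> J" "x \<in> S j" by auto
      then have "w x * indicator (S j) x \<le> (\<Sum>j\<in>J. w x * indicator (S j) x)"
        using assms(1) by (intro member_le_sum) auto
      with j show ?thesis by (auto simp: indicator_def)
    qed auto
  qed
  also have "\<dots> = (\<Sum>j\<in>J. \<integral>\<^sup>+x\<in>S j. w x \<partial>M)"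
    by (rule nn_integral_sum) (intro borel_measurable_times_ennreal assms borel_measurable_indicator)
  also have "\<dots> \<le> (\<Sum>j\<in>J. (MAX j\<in>J. \<integral>\<^sup>+x\<in>S j. w x \<partial>M))"
    using assms(1) by (intro sum_mono Max_ge) auto
  finally show ?thesis by (simp add: ennreal_of_nat_eq_real_of_nat)
qed

text \<open>The mass of a union is at most the number of pieces times the largest mass of a piece.
  Choosing the heaviest \<open>B j\<close> and the heaviest \<open>A i\<close> reduces the product
  to a single pair, so a bound for all pairs suffices.\<close>

lemma weight_product_UN_le:
  fixes u v :: "'a::euclidean_space \<Rightarrow> real"
  assumes pq: "1 < p" "1 < q"
    and u: "u \<in> borel_measurable lebesgue" and v: "v \<in> borel_measurable lebesgue"
    and J: "finite J" "J \<noteq> {}" "\<And>j. j \<in> J \<Longrightarrow> B j \<in> sets lebesgue"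
    and I: "finite I" "I \<noteq> {}" "\<And>i. i \<in> I \<Longrightarrow> A i \<in> sets lebesgue"
    and le: "\<And>i j. i \<in> I \<Longrightarrow> j \<in> J \<Longrightarrow> weight_product p q u v (B j) (A i) \<le> K"
  shows "weight_product p q u v (\<Union>j\<in>J. B j) (\<Union>i\<in>I. A i)
    \<le> ennreal (real (card J) powr (1 / q) * real (card I) powr (1 / conj_exponent p)) * K"
proof -
  define \<sigma> where "\<sigma> x = ennreal (v x) epowr (1 - conj_exponent p)" for x
  have q': "0 < 1 / q" and p': "0 < 1 / conj_exponent p" using pq by (simp_all add: conj_exponent_def)
  have \<sigma>: "\<sigma> \<in> borel_measurable lebesgue"
    unfolding \<sigma>_def[abs_def] by (intro borel_measurable_epowr measurable_compose[OF v measurable_ennreal])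
  have um: "(\<lambda>x. ennreal (u x)) \<in> borel_measurable lebesgue" by (rule measurable_compose[OF u measurable_ennreal])
  define b where "b j = (\<integral>\<^sup>+\<xi>\<in>B j. ennreal (u \<xi>) \<partial>lebesgue)" for j
  define a where "a i = (\<integral>\<^sup>+x\<in>A i. \<sigma> x \<partial>lebesgue)" for i
  have "Max (b ` J) \<in> b ` J" using J by (intro Max_in) auto
  then obtain j where j: "Max (b ` J) = b j" "j \<in> J" by (rule imageE)
  have "Max (a ` I) \<in> a ` I" using I by (intro Max_in) auto
  then obtain i where i: "Max (a ` I) = a i" "i \<in> I" by (rule imageE)
  have "weight_product p q u v (\<Union>j\<in>J. B j) (\<Union>i\<in>I. A i)
      \<le> (ennreal (real (card J)) * b j) epowr (1 / q) * (ennreal (real (card I)) * a i) epowr (1 / conj_exponent p)"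
    unfolding weight_product_def \<sigma>_def[symmetric]
  proof (intro mult_mono epowr_mono)
    show "(\<integral>\<^sup>+\<xi>\<in>(\<Union>j\<in>J. B j). ennreal (u \<xi>) \<partial>lebesgue) \<le> ennreal (real (card J)) * b j"
      using nn_integral_UN_le_card_mult_Max[where S=B, OF J(1,2) um J(3)] j unfolding b_def by simp
    show "(\<integral>\<^sup>+x\<in>(\<Union>i\<in>I. A i). \<sigma> x \<partial>lebesgue) \<le> ennreal (real (card I)) * a i"
      using nn_integral_UN_le_card_mult_Max[where S=A, OF I(1,2) \<sigma> I(3)] i unfolding a_def by simp
  qed (use pq p' in auto)
  also have "\<dots> = ennreal (real (card J) powr (1 / q) * real (card I) powr (1 / conj_exponent p))
      * (b j epowr (1 / q) * a i epowr (1 / conj_exponent p))"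
    unfolding epowr_cmult[OF of_nat_0_le_iff q'] epowr_cmult[OF of_nat_0_le_iff p']
    by (simp add: ennreal_mult' mult_ac)
  also have "b j epowr (1 / q) * a i epowr (1 / conj_exponent p) = weight_product p q u v (B j) (A i)"
    by (simp add: weight_product_def a_def b_def \<sigma>_def)
  also have "\<dots> \<le> K" by (rule le[OF i(2) j(2)])
  finally show ?thesis by (simp add: mult_left_mono)
qed

section \<open>The Bessel function and its first zero\<close>

text \<open>The hypergeometric function 0F1(; b; -z). For b > 0 it is entire in z with value 1 at 0,
  and thus free of the factor t^a of the Bessel function, which is singular at 0 when a = -1/2, the
  case of dimension 1.\<close>

definition bessel_clifford :: "real \<Rightarrow> real \<Rightarrow> real" where
  "bessel_clifford b z = (\<Sum>k. (- z) ^ k / (fact k * pochhammer b k))"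

lemma summable_power_over_fact_pochhammer:
  fixes b x :: real
  assumes "0 < b"
  shows "summable (\<lambda>k. x ^ k / (fact k * pochhammer b k))"
proof (cases "x = 0")
  case False
  show ?thesis
  proof (rule summable_ratio_test)
    \<comment> \<open>From this index on the ratio |x| / ((n + 1)(b + n)) of consecutive terms is at
      most 1/2, because (n + 1)(b + n) >= n b.\<close>
    fix n assume n: "n \<ge> nat \<lceil>2 * \<bar>x\<bar> / b\<rceil>"
    have "2 * \<bar>x\<bar> / b \<le> real n" using n by linarith
    then have "2 * \<bar>x\<bar> \<le> real n * b" using assms by (simp add: field_simps)
    also have "\<dots> \<le> (real n + 1) * (b + real n)"
      using assms by (intro mult_mono) auto
    finally have "2 * \<bar>x\<bar> \<le> (real n + 1) * (b + real n)" .
    moreover have "0 < (real n + 1) * (b + real n)" using assms by (intro mult_pos_pos) auto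
    ultimately have le: "\<bar>x\<bar> / ((real n + 1) * (b + real n)) \<le> 1 / 2"
      by (subst pos_divide_le_eq) auto
    have "norm (x ^ Suc n / (fact (Suc n) * pochhammer b (Suc n)))
        = \<bar>x\<bar> / ((real n + 1) * (b + real n)) * norm (x ^ n / (fact n * pochhammer b n))"
      using pochhammer_pos[OF assms, of n] assms by (simp add: abs_mult abs_divide pochhammer_Suc field_simps)
    also have "\<dots> \<le> 1 / 2 * norm (x ^ n / (fact n * pochhammer b n))"
      by (rule mult_right_mono[OF le]) simp
    finally show "norm (x ^ Suc n / (fact (Suc n) * pochhammer b (Suc n))) \<le> 1 / 2 * norm (x ^ n / (fact n * pochhammer b n))" .
  qed simp
qed (auto intro!: summable_finite[of "{0}"] simp: power_0_left split: if_splits)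

lemma bessel_clifford_0: "bessel_clifford b 0 = 1"
  unfolding bessel_clifford_def by (subst suminf_finite[of "{0}"]) auto

lemma continuous_on_bessel_clifford:
  assumes "0 < b" shows "continuous_on S (bessel_clifford b)"
proof -
  have "isCont (\<lambda>x. \<Sum>k. 1 / (fact k * pochhammer b k) * x ^ k) x" for x
  proof (rule isCont_powser)
    show "summable (\<lambda>k. 1 / (fact k * pochhammer b k) * (\<bar>x\<bar> + 1) ^ k)"
      using summable_power_over_fact_pochhammer[OF assms, of "\<bar>x\<bar> + 1"] by simp
  qed simp
  then have "continuous_on UNIV (\<lambda>x. \<Sum>k. 1 / (fact k * pochhammer b k) * x ^ k)"
    by (simp add: continuous_at_imp_continuous_on)
  then have "continuous_on S (\<lambda>z. (\<Sum>k. 1 / (fact k * pochhammer b k) * (- z) ^ k))"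
    by (rule continuous_on_compose2) (auto intro!: continuous_intros)
  then show ?thesis by (simp add: bessel_clifford_def[abs_def])
qed

text \<open>The functional equation of Gamma splits off \<open>rGamma (a + 1)\<close> and leaves a
  Pochhammer symbol. The prefactor vanishes nowhere in the given range, so the positive zeros of
  both functions correspond.\<close>

lemma bessel_J_eq_bessel_clifford:
  assumes "0 < t" "- 1 < a"
  shows "bessel_J a t = (t / 2) powr a * rGamma (a + 1) * bessel_clifford (a + 1) ((t / 2)\<^sup>2)"
proof -
  have b: "0 < a + 1" using assms by simp
  have eq: "(- 1) ^ k * rGamma (real k + a + 1) / fact k * (t / 2) powr (2 * real k + a)
      = ((t / 2) powr a * rGamma (a + 1)) * ((- ((t / 2)\<^sup>2)) ^ k / (fact k * pochhammer (a + 1) k))" for k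
  proof -
    have "pochhammer (a + 1) k > 0" using b by (rule pochhammer_pos)
    then have 1: "rGamma (real k + a + 1) = rGamma (a + 1) / pochhammer (a + 1) k"
      using pochhammer_rGamma[of "a + 1" k] by (simp add: field_simps)
    have 2: "(t / 2) powr (2 * real k + a) = (t / 2) powr a * ((t / 2)\<^sup>2) ^ k"
    proof -
      have "(t / 2) powr (2 * real k) = ((t / 2)\<^sup>2) ^ k"
        using assms powr_realpow[of "t / 2" "2 * k"] by (simp add: power_mult)
      then show ?thesis by (simp add: powr_add)
    qed
    have 3: "(- ((t / 2)\<^sup>2)) ^ k = (- 1) ^ k * ((t / 2)\<^sup>2) ^ k" by (rule power_minus)
    show ?thesis unfolding 1 2 3 by (simp add: mult_ac)
  qed
  show ?thesis
    unfolding bessel_J_def eq bessel_clifford_def[of "a + 1"]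
    by (rule suminf_mult) (rule summable_power_over_fact_pochhammer[OF b])
qed

lemma exp_weighted_sums:
  fixes s b :: real
  shows "(\<lambda>k. (- s) ^ k / fact k * (b + real k)) sums (exp (- s) * (b - s))"
proof -
  have e: "(\<lambda>k. (- s) ^ k / fact k) sums exp (- s)"
    using exp_converges[of "- s"] by (simp add: divide_inverse mult.commute)
  have "(\<lambda>k. (- s) ^ Suc k / fact (Suc k) * real (Suc k)) sums (exp (- s) * (- s))"
    using sums_mult2[OF e, of "- s"] by (simp add: field_simps del: of_nat_Suc)
  then have "(\<lambda>k. (- s) ^ k / fact k * real k) sums (exp (- s) * (- s))"
    by (subst (asm) sums_Suc_iff) simp
  from sums_add[OF sums_mult2[OF e, of b] this] show ?thesis
    by (simp add: algebra_simps add_divide_distrib)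
qed

text \<open>Averaging against \<open>y\<^sup>b e\<^sup>-\<^sup>y\<close> turns the series termwise into an elementary one:
  the integral of \<open>bessel_clifford b (s y)\<close> is \<open>\<Gamma>(b) e\<^sup>-\<^sup>s (b - s)\<close>, which is negative for s > b.\<close>

lemma bessel_clifford_takes_negative_value:
  assumes b: "0 < b" shows "\<exists>z>0. bessel_clifford b z < 0"
proof (rule ccontr)
  assume "\<not> (\<exists>z>0. bessel_clifford b z < 0)"
  then have nonneg: "0 \<le> bessel_clifford b z" if "0 < z" for z using that by force
  \<comment> \<open>Any s > b works; this choice makes b - s equal to -1.\<close>
  define s where "s = b + 1"
  have s: "0 < s" using b by (simp add: s_def)
  \<comment> \<open>The exponent b is essential: the weight y^(b-1) e^(-y) would give \<Gamma>(b)
    e^(-s), which is positive. The extra y contributes b + k to the k-th term and thereby the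
    sign-changing factor b - s.\<close>
  define g where "g k y = indicator {0<..} y * (y powr (b + real k) / exp y)" for k y
  have g: "has_bochner_integral lborel (g k) (Gamma (b + real k + 1))" for k
  proof (rule has_bochner_integral_nn_integral)
    have "Gamma (b + real k + 1) = (\<integral>\<^sup>+t. ennreal (indicator {0..} t * t powr (b + real k + 1 - 1) / exp t) \<partial>lborel)"
      using b by (intro Gamma_conv_nn_integral_real) auto
    also have "\<dots> = (\<integral>\<^sup>+y. ennreal (g k y) \<partial>lborel)"
      using b by (intro nn_integral_cong) (auto simp: g_def indicator_def)
    finally show "(\<integral>\<^sup>+y. ennreal (g k y) \<partial>lborel) = ennreal (Gamma (b + real k + 1))" by simp
    show "0 \<le> Gamma (b + real k + 1)" using b by (intro Gamma_real_nonneg) auto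
    show "g k \<in> borel_measurable lborel" unfolding g_def[abs_def] by measurable
  qed (auto simp: g_def)
  have gI: "integrable lborel (g k)" "(LINT y|lborel. g k y) = Gamma (b + real k + 1)" for k
    using g[of k] by (auto simp: has_bochner_integral_iff)
  define f where "f k y = (- s) ^ k / (fact k * pochhammer b k) * g k y" for k y
  have fI: "integrable lborel (f k)" for k unfolding f_def[abs_def] using gI by simp
  have Gam: "Gamma (b + real k + 1) = Gamma b * pochhammer b k * (b + real k)" for k
  proof -
    have "Gamma (b + real k + 1) = (b + real k) * Gamma (b + real k)"
      using b by (intro Gamma_plus1) (auto dest: nonpos_Ints_nonpos)
    also have "Gamma (b + real k) = Gamma b * pochhammer b k"
    proof -
      have "b \<notin> \<int>\<^sub>\<le>\<^sub>0" using b nonpos_Ints_nonpos by force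
      then show ?thesis using pochhammer_Gamma[of b k] Gamma_real_pos[OF b] by simp
    qed
    finally show ?thesis by simp
  qed
  have fint: "(LINT y|lborel. f k y) = Gamma b * ((- s) ^ k / fact k * (b + real k))" for k
    using pochhammer_pos[OF b, of k] unfolding f_def by (simp add: gI Gam)
  have fy: "f k y = indicator {0<..} y * (y powr b / exp y) * ((- (s * y)) ^ k / (fact k * pochhammer b k))" for k y
  proof (cases "0 < y")
    case True
    have "(- (s * y)) ^ k = (- s) ^ k * y ^ k" by (metis mult_minus_left power_mult_distrib)
    with True show ?thesis by (simp add: f_def g_def powr_add powr_realpow mult_ac)
  qed (simp add: f_def g_def)
  have normf: "norm (f k y) = s ^ k / (fact k * pochhammer b k) * g k y" for k y
    using s pochhammer_pos[OF b, of k] by (simp add: f_def g_def abs_mult abs_divide power_abs)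
  have "(\<lambda>k. LINT y|lborel. f k y) sums (LINT y|lborel. (\<Sum>k. f k y))"
  proof (rule sums_integral[OF fI])
    show "AE y in lborel. summable (\<lambda>k. norm (f k y))"
    proof (rule AE_I2)
      fix y
      have "summable (\<lambda>k. \<bar>indicator {0<..} y * (y powr b / exp y)\<bar> * (\<bar>s * y\<bar> ^ k / (fact k * pochhammer b k)))"
        by (intro summable_mult summable_power_over_fact_pochhammer b)
      then show "summable (\<lambda>k. norm (f k y))"
        by (simp add: fy abs_mult abs_divide power_abs abs_of_pos[OF pochhammer_pos[OF b]])
    qed
    \<comment> \<open>The integrals of the absolute values form the same elementary series with -s
      in place of s.\<close>
    have "summable (\<lambda>k. Gamma b * ((- (- s)) ^ k / fact k * (b + real k)))"
      using exp_weighted_sums[of "- s" b] by (intro summable_mult) (rule sums_summable)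
    moreover have "(LINT y|lborel. norm (f k y)) = Gamma b * ((- (- s)) ^ k / fact k * (b + real k))" for k
      using pochhammer_pos[OF b, of k] unfolding normf by (simp add: gI Gam)
    ultimately show "summable (\<lambda>k. LINT y|lborel. norm (f k y))" by simp
  qed
  moreover have "(\<lambda>k. LINT y|lborel. f k y) sums (Gamma b * (exp (- s) * (b - s)))"
    unfolding fint by (intro sums_mult exp_weighted_sums)
  ultimately have "(LINT y|lborel. (\<Sum>k. f k y)) = Gamma b * (exp (- s) * (b - s))"
    by (rule sums_unique2)
  moreover have "0 \<le> (LINT y|lborel. (\<Sum>k. f k y))"
  proof (intro integral_nonneg_AE AE_I2)
    fix y
    have "(\<Sum>k. f k y) = indicator {0<..} y * (y powr b / exp y) * bessel_clifford b (s * y)"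
      unfolding fy bessel_clifford_def by (rule suminf_mult) (rule summable_power_over_fact_pochhammer[OF b])
    then show "0 \<le> (\<Sum>k. f k y)" using nonneg[of "s * y"] s by (auto simp: indicator_def)
  qed
  moreover have "Gamma b * (exp (- s) * (b - s)) < 0"
    using Gamma_real_pos[OF b] by (simp add: s_def mult_less_0_iff)
  ultimately show False by simp
qed

text \<open>The identity (2k)! = 4^k k! (1/2)_k matches the coefficients with the cosine series. It
  identifies the kernel in dimension 1 and also writes cos (x \<bullet> \<xi>), in any dimension, as
  a series of the same family.\<close>

lemma bessel_clifford_half: "bessel_clifford (1 / 2) (t\<^sup>2 / 4) = cos t"
proof -
  have dbl: "(2::real) ^ (2 * k) * fact k * pochhammer (1 / 2) k = fact (2 * k)" for k
    by (simp add: fact_double)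
  have eq: "(- (t\<^sup>2 / 4)) ^ k / (fact k * pochhammer (1 / 2) k) = (- 1) ^ k * t ^ (2 * k) / fact (2 * k)" for k
  proof -
    have "(- (t\<^sup>2 / 4)) ^ k = (- 1) ^ k * t ^ (2 * k) / 2 ^ (2 * k)"
      by (subst power_minus) (simp add: power_divide power_mult)
    then show ?thesis by (simp add: dbl[of k, symmetric])
  qed
  have "(\<lambda>k. (- 1) ^ k * t ^ (2 * k) / fact (2 * k)) sums cos t"
    using cos_paired[of t] by (simp add: field_simps)
  then show ?thesis
    unfolding bessel_clifford_def eq by (rule sums_unique[symmetric])
qed

text \<open>For b >= 1 and 0 <= z < 1 the absolute values of the terms decrease, so the alternating
  series is at least its first two terms, 1 - z / b > 0.\<close>

lemma bessel_clifford_pos: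
  assumes b: "1 \<le> b" and z: "0 \<le> z" "z < 1" shows "0 < bessel_clifford b z"
proof -
  define a where "a k = z ^ k / (fact k * pochhammer b k)" for k
  have pos: "0 < pochhammer b k" for k using b by (intro pochhammer_pos) auto
  have "a \<longlonglongrightarrow> 0"
    unfolding a_def using b by (intro summable_LIMSEQ_zero summable_power_over_fact_pochhammer) auto
  moreover have "0 \<le> a k" for k using z pos[of k] by (simp add: a_def)
  moreover have "a (Suc k) \<le> a k" for k
  proof -
    have "1 * 1 \<le> (1 + real k) * (b + real k)" using b by (intro mult_mono) auto
    then have "z / ((1 + real k) * (b + real k)) \<le> 1" using z by (simp add: field_simps)
    then have "z / ((1 + real k) * (b + real k)) * a k \<le> 1 * a k"
      using \<open>0 \<le> a k\<close> by (rule mult_right_mono)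
    moreover have "a (Suc k) = z / ((1 + real k) * (b + real k)) * a k"
      by (simp add: a_def pochhammer_Suc field_simps)
    ultimately show ?thesis by simp
  qed
  ultimately have "(\<Sum>i<2*1. (-1)^i * a i) \<le> (\<Sum>i. (-1)^i * a i)"
    by (rule summable_Leibniz'(2))
  moreover have "(-1)^i * a i = (- z) ^ i / (fact i * pochhammer b i)" for i
    unfolding a_def by (subst (2) power_minus) simp
  moreover have "(\<Sum>i<2*1. (-1)^i * a i) = 1 - z / b" by (simp add: a_def numeral_2_eq_2)
  moreover have "z / b < 1" using b z by (simp add: field_simps)
  ultimately show ?thesis by (simp add: bessel_clifford_def)
qed

lemma bessel_J_zero_iff:
  assumes "0 < b" "0 < t"
  shows "bessel_J (b - 1) t = 0 \<longleftrightarrow> bessel_clifford b ((t / 2)\<^sup>2) = 0"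
proof -
  have "b \<notin> \<int>\<^sub>\<le>\<^sub>0" using assms nonpos_Ints_nonpos by force
  then have "rGamma b \<noteq> 0" by (simp add: rGamma_eq_zero_iff)
  then show ?thesis
    using bessel_J_eq_bessel_clifford[of t "b - 1"] assms by simp
qed

text \<open>\<open>LEAST\<close> over the reals denotes the first zero only if a minimum is
  attained. The zeros up to some known zero \<open>t1\<close> form a compact set that omits 0, where
  the series equals 1; the intermediate value theorem then gives positivity before the first of
  them.\<close>

lemma bessel_J_first_zero:
  assumes b: "0 < b"
  shows "0 < bessel_J_first_zero (b - 1)" "bessel_J (b - 1) (bessel_J_first_zero (b - 1)) = 0"
    and "\<And>t. 0 \<le> t \<Longrightarrow> t < bessel_J_first_zero (b - 1) \<Longrightarrow> 0 < bessel_clifford b ((t / 2)\<^sup>2)"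
proof -
  define \<phi> where "\<phi> t = bessel_clifford b ((t / 2)\<^sup>2)" for t
  have \<phi>c: "continuous_on S \<phi>" for S
    unfolding \<phi>_def[abs_def]
    by (rule continuous_on_compose2[OF continuous_on_bessel_clifford[OF b, of UNIV]]) (auto intro!: continuous_intros)
  have \<phi>0: "\<phi> 0 = 1" by (simp add: \<phi>_def bessel_clifford_0)
  have ivt: "\<exists>s. 0 < s \<and> s \<le> t \<and> \<phi> s = 0" if "0 \<le> t" "\<phi> t \<le> 0" for t
  proof -
    have "\<exists>s\<ge>0. s \<le> t \<and> \<phi> s = 0"
      using IVT2'[of \<phi> t 0 0] that \<phi>0 \<phi>c by auto
    then obtain s where "0 \<le> s" "s \<le> t" "\<phi> s = 0" by blast
    moreover have "s \<noteq> 0" using \<phi>0 \<open>\<phi> s = 0\<close> by auto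
    ultimately show ?thesis by (intro exI[of _ s]) auto
  qed
  obtain z where z: "0 < z" "bessel_clifford b z < 0"
    using bessel_clifford_takes_negative_value[OF b] by auto
  have "\<phi> (2 * sqrt z) < 0" using z by (simp add: \<phi>_def)
  with ivt[of "2 * sqrt z"] z obtain t1 where t1: "0 < t1" "\<phi> t1 = 0" by auto
  define Z where "Z = {t \<in> {0..t1}. \<phi> t = 0}"
  have "compact Z"
  proof -
    have "closed Z" unfolding Z_def
      by (rule continuous_closed_preimage_constant[OF \<phi>c]) auto
    moreover have "bounded Z" unfolding Z_def by (rule bounded_subset[of "{0..t1}"]) auto
    ultimately show ?thesis by (simp add: compact_eq_bounded_closed)
  qed
  moreover have "Z \<noteq> {}" using t1 by (auto simp: Z_def)
  ultimately obtain j where j: "j \<in> Z" "\<And>t. t \<in> Z \<Longrightarrow> j \<le> t"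
    using compact_attains_inf[of Z] by auto
  have jpos: "0 < j" using j \<phi>0 by (cases "j = 0") (auto simp: Z_def)
  have jmin: "j \<le> t" if "0 < t" "\<phi> t = 0" for t
    using j(2)[of t] j(1) that by (cases "t \<le> t1") (auto simp: Z_def)
  have "bessel_J_first_zero (b - 1) = j"
    unfolding bessel_J_first_zero_def
  proof (rule Least_equality)
    show "0 < j \<and> bessel_J (b - 1) j = 0"
      using jpos j(1) bessel_J_zero_iff[OF b, of j] by (simp add: Z_def \<phi>_def)
    fix t assume "0 < t \<and> bessel_J (b - 1) t = 0"
    then show "j \<le> t" using jmin[of t] bessel_J_zero_iff[OF b, of t] by (simp add: \<phi>_def)
  qed
  then show "0 < bessel_J_first_zero (b - 1)" "bessel_J (b - 1) (bessel_J_first_zero (b - 1)) = 0"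
    "\<And>t. 0 \<le> t \<Longrightarrow> t < bessel_J_first_zero (b - 1) \<Longrightarrow> 0 < bessel_clifford b ((t / 2)\<^sup>2)"
    using jpos j(1) bessel_J_zero_iff[OF b, of j] ivt jmin
    by (auto simp: Z_def \<phi>_def) (metis dual_order.strict_trans2 not_le)
qed

text \<open>For n = 1 the kernel is cos. For n >= 2 the parameter n/2 is at least 1, and a zero j <
  pi/2 < 2 would have (j/2)^2 < 1, where the alternating series is positive.\<close>

lemma half_pi_le_bessel_J_first_zero:
  assumes "1 \<le> n" shows "pi / 2 \<le> bessel_J_first_zero (real n / 2 - 1)"
proof (rule ccontr)
  define j where "j = bessel_J_first_zero (real n / 2 - 1)"
  assume "\<not> pi / 2 \<le> bessel_J_first_zero (real n / 2 - 1)"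
  then have lt: "j < pi / 2" by (simp add: j_def)
  have b: "0 < real n / 2" using assms by simp
  have j: "0 < j" "bessel_clifford (real n / 2) ((j / 2)\<^sup>2) = 0"
    using bessel_J_first_zero[OF b] bessel_J_zero_iff[OF b] by (auto simp: j_def)
  have "0 < bessel_clifford (real n / 2) ((j / 2)\<^sup>2)"
  proof (cases "n = 1")
    case True
    have "0 < cos j" using j lt by (intro cos_gt_zero_pi) auto
    then show ?thesis using True bessel_clifford_half[of j] by (simp add: power_divide)
  next
    case False
    have "j / 2 < 1" using lt pi_less_4 by simp
    then have "(j / 2)\<^sup>2 < 1" using j by (simp add: abs_square_less_1)
    then show ?thesis using False assms by (intro bessel_clifford_pos) auto
  qed
  with j show False by simp
qed

section \<open>Fourier transforms of radial functions\<close>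

lemma nn_integral_lborel_affine:
  fixes f :: "'a::euclidean_space \<Rightarrow> ennreal"
  assumes f: "f \<in> borel_measurable borel" and c: "\<bar>c\<bar> = 1"
  shows "(\<integral>\<^sup>+x. f (t + c *\<^sub>R x) \<partial>lborel) = (\<integral>\<^sup>+x. f x \<partial>lborel)"
proof -
  have "c \<noteq> 0" using c by auto
  have "(\<integral>\<^sup>+x. f x \<partial>lborel) = (\<integral>\<^sup>+x. f x \<partial>density (distr lborel borel (\<lambda>x. t + c *\<^sub>R x)) (\<lambda>_. ennreal (\<bar>c\<bar> ^ DIM('a))))"
    using lborel_affine[OF \<open>c \<noteq> 0\<close>, of t] by simp
  also have "\<dots> = (\<integral>\<^sup>+x. f x \<partial>distr lborel borel (\<lambda>x. t + c *\<^sub>R x))"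
    using f c by (subst nn_integral_density) auto
  also have "\<dots> = (\<integral>\<^sup>+x. f (t + c *\<^sub>R x) \<partial>lborel)"
    using f by (intro nn_integral_distr) auto
  finally show ?thesis ..
qed

text \<open>Uniqueness of translation invariant measures by Fubini: for a rotation T and
  nonnegative f, g, the substitutions \<open>y \<rightarrow> y + T\<^sup>-\<^sup>1 x\<close>, \<open>x \<rightarrow> x - T y\<close> and \<open>y \<rightarrow> T\<^sup>-\<^sup>1 x - y\<close>
  give \<open>\<integral>f \<cdot> \<integral>g \<circ> T = \<integral>g \<cdot> \<integral>f \<circ> T\<close>; take g to be the indicator of a ball.\<close>

lemma nn_integral_lborel_orthogonal:
  fixes f :: "'a::euclidean_space \<Rightarrow> ennreal" and T :: "'a \<Rightarrow> 'a"
  assumes T: "orthogonal_transformation T" and f: "f \<in> borel_measurable borel"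
  shows "(\<integral>\<^sup>+x. f (T x) \<partial>lborel) = (\<integral>\<^sup>+x. f x \<partial>lborel)"
proof -
  have lin: "linear T" using T by (rule orthogonal_transformation_linear)
  have "continuous_on UNIV T" using lin by (rule linear_continuous_on[OF linear_conv_bounded_linear[THEN iffD1]])
  then have Tm: "T \<in> borel_measurable borel" by (rule borel_measurable_continuous_onI)
  define g :: "'a \<Rightarrow> ennreal" where "g = indicator (ball 0 1)"
  have g: "g \<in> borel_measurable borel" unfolding g_def by (intro borel_measurable_indicator borel_open open_ball)
  have gT: "g (T y) = g y" for y
    using orthogonal_transformation_norm[OF T] by (simp add: g_def indicator_def)
  note [measurable] = f g Tm
  define N where "N = (\<integral>\<^sup>+x. g x \<partial>lborel)"
  have N: "N = emeasure lborel (ball (0::'a) 1)" by (simp add: N_def g_def)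
  have fT: "(\<lambda>y. f (T y)) \<in> borel_measurable borel" using measurable_compose[OF Tm f] .
  have gT': "(\<lambda>y. g (T y)) \<in> borel_measurable borel" using measurable_compose[OF Tm g] .
  have surj: "\<exists>y0. T y0 = x" for x using orthogonal_transformation_surj[OF T] by (metis surjD)
  have "(\<integral>\<^sup>+x. f x \<partial>lborel) * N = (\<integral>\<^sup>+x. f x * (\<integral>\<^sup>+y. g (T y) \<partial>lborel) \<partial>lborel)"
    using f by (simp add: gT N_def nn_integral_multc)
  also have "\<dots> = (\<integral>\<^sup>+x. \<integral>\<^sup>+y. f x * g (T y + x) \<partial>lborel \<partial>lborel)"
  proof (rule nn_integral_cong)
    fix x
    obtain y0 where y0: "T y0 = x" using surj by blast
    have "(\<integral>\<^sup>+y. g (T y) \<partial>lborel) = (\<integral>\<^sup>+y. g (T (y0 + 1 *\<^sub>R y)) \<partial>lborel)"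
      by (rule nn_integral_lborel_affine[symmetric, OF gT']) simp
    also have "\<dots> = (\<integral>\<^sup>+y. g (T y + x) \<partial>lborel)"
      by (simp add: linear_add[OF lin] y0 add.commute)
    finally show "f x * (\<integral>\<^sup>+y. g (T y) \<partial>lborel) = (\<integral>\<^sup>+y. f x * g (T y + x) \<partial>lborel)"
      using g Tm by (subst nn_integral_cmult) auto
  qed
  also have "\<dots> = (\<integral>\<^sup>+y. \<integral>\<^sup>+x. f x * g (T y + x) \<partial>lborel \<partial>lborel)"
    by (intro lborel_pair.Fubini') measurable
  also have "\<dots> = (\<integral>\<^sup>+y. \<integral>\<^sup>+x. f (x - T y) * g x \<partial>lborel \<partial>lborel)"
  proof (rule nn_integral_cong)
    fix y
    have "(\<lambda>x. f (x - T y) * g x) \<in> borel_measurable borel" using f g by measurable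
    from nn_integral_lborel_affine[OF this, of 1 "T y"]
    show "(\<integral>\<^sup>+x. f x * g (T y + x) \<partial>lborel) = (\<integral>\<^sup>+x. f (x - T y) * g x \<partial>lborel)" by simp
  qed
  also have "\<dots> = (\<integral>\<^sup>+x. \<integral>\<^sup>+y. f (x - T y) * g x \<partial>lborel \<partial>lborel)"
    by (intro lborel_pair.Fubini') measurable
  also have "\<dots> = (\<integral>\<^sup>+x. (\<integral>\<^sup>+y. f (T y) \<partial>lborel) * g x \<partial>lborel)"
  proof (rule nn_integral_cong)
    fix x
    obtain y0 where y0: "T y0 = x" using surj by blast
    have "(\<integral>\<^sup>+y. f (T y) \<partial>lborel) = (\<integral>\<^sup>+y. f (T (y0 + (-1) *\<^sub>R y)) \<partial>lborel)"
      by (rule nn_integral_lborel_affine[symmetric, OF fT]) simp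
    also have "\<dots> = (\<integral>\<^sup>+y. f (x - T y) \<partial>lborel)"
      by (simp add: linear_diff[OF lin] y0)
    finally show "(\<integral>\<^sup>+y. f (x - T y) * g x \<partial>lborel) = (\<integral>\<^sup>+y. f (T y) \<partial>lborel) * g x"
      using f Tm by (subst nn_integral_multc) auto
  qed
  also have "\<dots> = (\<integral>\<^sup>+y. f (T y) \<partial>lborel) * N"
    using g by (simp add: N_def nn_integral_cmult)
  finally have "(\<integral>\<^sup>+x. f x \<partial>lborel) * N = (\<integral>\<^sup>+y. f (T y) \<partial>lborel) * N" .
  \<comment> \<open>The unit ball has positive finite measure, so its mass can be cancelled.\<close>
  moreover have "N \<noteq> 0" "N \<noteq> top"
    unfolding N using emeasure_lborel_ball_finite[of "0::'a" 1] open_ball[of "0::'a" 1]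
    by (auto simp: emeasure_ball unit_ball_vol_def ennreal_eq_0_iff not_le Gamma_real_pos)
  ultimately show ?thesis
    by (metis ennreal_mult_cancel_left mult.commute)
qed

text \<open>The weights are only Lebesgue measurable, so invariance has to pass from Borel sets to
  the completion; preserving the Borel measure makes preimages of null sets null.\<close>

lemma
  fixes T :: "'a::euclidean_space \<Rightarrow> 'a"
  assumes T: "orthogonal_transformation T"
  shows lebesgue_measurable_orthogonal: "T \<in> lebesgue \<rightarrow>\<^sub>M lebesgue"
    and distr_lebesgue_orthogonal: "distr lebesgue lebesgue T = lebesgue"
proof -
  have lin: "linear T" using T by (rule orthogonal_transformation_linear)
  have "continuous_on UNIV T" using lin by (rule linear_continuous_on[OF linear_conv_bounded_linear[THEN iffD1]])
  then have Tm: "T \<in> borel_measurable borel" by (rule borel_measurable_continuous_onI)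
  have Tm1: "T \<in> lborel \<rightarrow>\<^sub>M lborel" and Tm2: "T \<in> lebesgue \<rightarrow>\<^sub>M lborel"
    using Tm by (simp_all add: measurable_completion)
  have "distr lborel lborel T = lborel"
  proof (rule measure_eqI)
    fix S assume "S \<in> sets (distr lborel lborel T)"
    then have S: "S \<in> sets borel" by simp
    have "emeasure (distr lborel lborel T) S = (\<integral>\<^sup>+x. indicator S x \<partial>distr lborel lborel T)"
      using S by simp
    also have "\<dots> = (\<integral>\<^sup>+x. indicator S (T x) \<partial>lborel)"
      by (rule nn_integral_distr[OF Tm1]) (use S in simp)
    also have "\<dots> = (\<integral>\<^sup>+x. indicator S x \<partial>lborel)"
      by (rule nn_integral_lborel_orthogonal[OF T]) (use S in simp)
    finally show "emeasure (distr lborel lborel T) S = emeasure lborel S" using S by simp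
  qed simp
  then have d: "distr lebesgue lborel T = lborel" using distr_completion[OF Tm1] by simp
  show "T \<in> lebesgue \<rightarrow>\<^sub>M lebesgue"
    by (rule completion.measurable_completion2[OF Tm2]) (simp add: d)
  show "distr lebesgue lebesgue T = lebesgue"
    using completion.completion_distr_eq[OF Tm2] by (simp add: d)
qed

lemma integral_lebesgue_orthogonal:
  fixes f :: "'a::euclidean_space \<Rightarrow> real" and T :: "'a \<Rightarrow> 'a"
  assumes T: "orthogonal_transformation T" and f: "f \<in> borel_measurable lebesgue"
  shows "(LINT x|lebesgue. f (T x)) = (LINT x|lebesgue. f x)"
  using integral_distr[OF lebesgue_measurable_orthogonal[OF T] f] by (simp add: distr_lebesgue_orthogonal[OF T])

section \<open>Even moments of radial functions\<close>

lemma sum_even_terms: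
  "(\<Sum>j\<le>2*k. (if even j then c (j div 2) else 0) * t ^ j) = (\<Sum>i\<le>k. c i * (t::real) ^ (2 * i))"
  by (induction k) auto

text \<open>Bounded support makes the product with any continuous function integrable, so all
  moments exist. For radial v the truncated dual weight on a ball centred at 0 is an
  instance.\<close>

locale radial_function =
  fixes h :: "real ^ 'n \<Rightarrow> real" and R :: real
  assumes integrable: "integrable lebesgue h"
    and support: "\<And>x. x \<notin> cball 0 R \<Longrightarrow> h x = 0"
    and radial: "\<And>x y. norm x = norm y \<Longrightarrow> h x = h y"
begin

lemma integrable_mult_continuous:
  fixes g :: "real ^ 'n \<Rightarrow> real"
  assumes "continuous_on UNIV g" shows "integrable lebesgue (\<lambda>x. h x * g x)"
proof -
  have "compact (g ` cball 0 R)"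
    using assms by (intro compact_continuous_image) (auto intro: continuous_on_subset)
  then obtain B where B: "\<And>x. x \<in> cball 0 R \<Longrightarrow> \<bar>g x\<bar> \<le> B"
    by (metis bounded_iff compact_imp_bounded image_eqI real_norm_def)
  have "g \<in> borel_measurable lebesgue"
    using assms by (intro measurable_completion) (simp add: borel_measurable_continuous_onI)
  then have m: "(\<lambda>x. h x * g x) \<in> borel_measurable lebesgue"
    using integrable by (intro borel_measurable_times) auto
  have "norm (h x * g x) \<le> norm (B * h x)" for x
  proof (cases "x \<in> cball 0 R")
    case True
    then have "\<bar>g x\<bar> \<le> \<bar>B\<bar>" using B by force
    then show ?thesis using mult_left_mono[of "\<bar>g x\<bar>" "\<bar>B\<bar>" "\<bar>h x\<bar>"] by (simp add: abs_mult mult.commute)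
  qed (simp add: support)
  then show ?thesis
    using integrable by (intro Bochner_Integration.integrable_bound[OF _ m, of "\<lambda>x. B * h x"]) auto
qed

lemma integrable_mult_inner_powers:
  "integrable lebesgue (\<lambda>x. h x * ((x \<bullet> a) ^ i * (x \<bullet> b) ^ j))"
  by (intro integrable_mult_continuous continuous_intros)

lemma times_norm_squared: "radial_function (\<lambda>x. h x * (norm x)\<^sup>2) R"
proof
  show "integrable lebesgue (\<lambda>x. h x * (norm x)\<^sup>2)"
    by (intro integrable_mult_continuous continuous_intros)
  show "h x * (norm x)\<^sup>2 = h y * (norm y)\<^sup>2" if "norm x = norm y" for x y
    using radial[OF that] that by simp
qed (simp add: support)

lemma moment_cong_norm:
  assumes "norm \<xi> = norm \<zeta>"
  shows "(LINT x|lebesgue. h x * (x \<bullet> \<xi>) ^ m) = (LINT x|lebesgue. h x * (x \<bullet> \<zeta>) ^ m)"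
proof -
  obtain T where T: "orthogonal_transformation T" "T \<xi> = \<zeta>"
    using orthogonal_transformation_exists[OF assms] .
  have "(LINT x|lebesgue. h x * (x \<bullet> \<zeta>) ^ m) = (LINT x|lebesgue. h (T x) * (T x \<bullet> \<zeta>) ^ m)"
    by (rule integral_lebesgue_orthogonal[symmetric, OF T(1)])
      (intro borel_measurable_integrable integrable_mult_continuous continuous_intros)
  also have "\<dots> = (LINT x|lebesgue. h x * (x \<bullet> \<xi>) ^ m)"
    using T radial[OF orthogonal_transformation_norm[OF T(1)]] by (simp add: orthogonal_transformation_def flip: T(2))
  finally show ?thesis ..
qed

text \<open>Compare the coefficients of \<open>t\<^sup>2\<close> in \<open>\<integral>h (x \<bullet> (e + t b))\<^bsup>2k\<^esup> = (1 + t\<^sup>2)\<^sup>k \<integral>h (x \<bullet> e)\<^bsup>2k\<^esup>\<close>.\<close>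

lemma mixed_moment:
  assumes e: "norm e = 1" and b: "norm b = 1" and eb: "e \<bullet> b = 0"
  shows "(2 * real k + 1) * (LINT x|lebesgue. h x * ((x \<bullet> b)\<^sup>2 * (x \<bullet> e) ^ (2 * k)))
    = (LINT x|lebesgue. h x * (x \<bullet> e) ^ (2 * Suc k))"
proof -
  \<comment> \<open>With exponent 2K = 2k + 2 the coefficient of t^2 carries the power 2k of x
    \<bullet> e.\<close>
  define K where "K = Suc k"
  define M where "M = (LINT x|lebesgue. h x * (x \<bullet> e) ^ (2 * K))"
  define c where "c j = real (2 * K choose j) * (LINT x|lebesgue. h x * ((x \<bullet> b) ^ j * (x \<bullet> e) ^ (2 * K - j)))" for j
  have "(\<Sum>j\<le>2*K. c j * t ^ j) = (\<Sum>j\<le>2*K. (if even j then M * real (K choose (j div 2)) else 0) * t ^ j)" for t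
  proof -
    define r where "r = sqrt (1 + t\<^sup>2)"
    have rK: "r ^ (2 * K) = (1 + t\<^sup>2) ^ K" by (simp add: r_def power_mult)
    have "(norm (e + t *\<^sub>R b))\<^sup>2 = 1 + t\<^sup>2"
      using e b eb unfolding power2_norm_eq_inner
      by (simp add: inner_add_left inner_add_right inner_commute norm_eq_1 power2_eq_square)
    then have "norm (e + t *\<^sub>R b) = norm (r *\<^sub>R e)"
      using e by (simp add: r_def real_sqrt_unique)
    then have "(LINT x|lebesgue. h x * (x \<bullet> (e + t *\<^sub>R b)) ^ (2 * K)) = (LINT x|lebesgue. h x * (x \<bullet> (r *\<^sub>R e)) ^ (2 * K))"
      by (rule moment_cong_norm)
    also have "\<dots> = (LINT x|lebesgue. (1 + t\<^sup>2) ^ K * (h x * (x \<bullet> e) ^ (2 * K)))"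
      unfolding inner_scaleR_right power_mult_distrib rK by (simp only: mult.left_commute)
    also have "\<dots> = (1 + t\<^sup>2) ^ K * M" by (simp add: M_def)
    also have "(1 + t\<^sup>2) ^ K * M = (\<Sum>i\<le>K. (M * real (K choose i)) * t ^ (2 * i))"
      using binomial_ring[of "t\<^sup>2" 1 K] by (simp add: add.commute sum_distrib_left mult_ac flip: power_mult)
    also have "\<dots> = (\<Sum>j\<le>2*K. (if even j then M * real (K choose (j div 2)) else 0) * t ^ j)"
      by (rule sum_even_terms[symmetric])
    also have "(LINT x|lebesgue. h x * (x \<bullet> (e + t *\<^sub>R b)) ^ (2 * K))
        = (LINT x|lebesgue. (\<Sum>j\<le>2*K. (real (2 * K choose j) * t ^ j) * (h x * ((x \<bullet> b) ^ j * (x \<bullet> e) ^ (2 * K - j)))))"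
    proof (rule Bochner_Integration.integral_cong)
      fix x
      have "(x \<bullet> (e + t *\<^sub>R b)) ^ (2 * K) = (t * (x \<bullet> b) + x \<bullet> e) ^ (2 * K)"
        by (simp add: inner_add_right add.commute)
      also have "\<dots> = (\<Sum>j\<le>2*K. real (2 * K choose j) * (t * (x \<bullet> b)) ^ j * (x \<bullet> e) ^ (2 * K - j))"
        by (rule binomial_ring)
      finally show "h x * (x \<bullet> (e + t *\<^sub>R b)) ^ (2 * K)
          = (\<Sum>j\<le>2*K. (real (2 * K choose j) * t ^ j) * (h x * ((x \<bullet> b) ^ j * (x \<bullet> e) ^ (2 * K - j))))"
        by (simp add: sum_distrib_left power_mult_distrib mult_ac)
    qed simp
    also have "\<dots> = (\<Sum>j\<le>2*K. c j * t ^ j)"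
      unfolding c_def
      by (subst Bochner_Integration.integral_sum, intro integrable_mult_right integrable_mult_inner_powers)
        (rule sum.cong, simp, subst integral_mult_right_zero, simp)
    finally show ?thesis .
  qed
  \<comment> \<open>Polynomials that agree for all real t have equal coefficients. In degree 2 the
    binomials are K (2k + 1) on one side and K on the other, and K cancels.\<close>
  then have "\<forall>j\<le>2*K. c j = (if even j then M * real (K choose (j div 2)) else 0)"
    by (subst polyfun_eq_coeffs[symmetric]) blast
  then have "c 2 = M * real K" using K_def by (auto dest: spec[of _ 2])
  moreover have "real (2 * K choose 2) = real K * (2 * real k + 1)"
  proof -
    have "(2 * K choose 2) = K * (2 * k + 1)" by (simp add: choose_two K_def)
    then show ?thesis by (simp add: algebra_simps)
  qed
  ultimately show ?thesis
    unfolding c_def M_def by (simp add: K_def)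
qed

text \<open>Expand |x|^2 over the basis: the direction e contributes the moment M of order 2k + 2,
  and each of the n - 1 others M / (2k + 1). The total is M (n + 2k) / (2k + 1).\<close>

lemma moment_Suc:
  assumes e: "e \<in> Basis"
  shows "(real CARD('n) / 2 + real k) * (LINT x|lebesgue. h x * (x \<bullet> e) ^ (2 * Suc k))
    = (1 / 2 + real k) * (LINT x|lebesgue. h x * (norm x)\<^sup>2 * (x \<bullet> e) ^ (2 * k))"
proof -
  define M where "M = (LINT x|lebesgue. h x * (x \<bullet> e) ^ (2 * Suc k))"
  define X where "X = (LINT x|lebesgue. h x * (norm x)\<^sup>2 * (x \<bullet> e) ^ (2 * k))"
  have I: "integrable lebesgue (\<lambda>x. h x * ((x \<bullet> b)\<^sup>2 * (x \<bullet> e) ^ (2 * k)))" for b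
    by (rule integrable_mult_inner_powers)
  have ee: "(LINT x|lebesgue. h x * ((x \<bullet> e)\<^sup>2 * (x \<bullet> e) ^ (2 * k))) = M"
    by (simp add: M_def power2_eq_square mult.assoc)
  have "(LINT x|lebesgue. h x * (norm x)\<^sup>2 * (x \<bullet> e) ^ (2 * k))
      = (LINT x|lebesgue. (\<Sum>b\<in>Basis. h x * ((x \<bullet> b)\<^sup>2 * (x \<bullet> e) ^ (2 * k))))"
  proof (rule Bochner_Integration.integral_cong)
    fix x :: "real ^ 'n"
    have "(norm x)\<^sup>2 = (\<Sum>b\<in>Basis. (x \<bullet> b)\<^sup>2)"
      unfolding power2_norm_eq_inner by (subst euclidean_inner) (simp add: power2_eq_square)
    then show "h x * (norm x)\<^sup>2 * (x \<bullet> e) ^ (2 * k) = (\<Sum>b\<in>Basis. h x * ((x \<bullet> b)\<^sup>2 * (x \<bullet> e) ^ (2 * k)))"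
      by (simp add: sum_distrib_left sum_distrib_right mult.assoc)
  qed simp
  also have "\<dots> = (\<Sum>b\<in>Basis. (LINT x|lebesgue. h x * ((x \<bullet> b)\<^sup>2 * (x \<bullet> e) ^ (2 * k))))"
    by (rule Bochner_Integration.integral_sum) (rule I)
  also have "\<dots> = M + (\<Sum>b\<in>Basis - {e}. (LINT x|lebesgue. h x * ((x \<bullet> b)\<^sup>2 * (x \<bullet> e) ^ (2 * k))))"
    using e by (subst sum.remove[of _ e]) (auto simp: ee)
  also have "(\<Sum>b\<in>Basis - {e}. (LINT x|lebesgue. h x * ((x \<bullet> b)\<^sup>2 * (x \<bullet> e) ^ (2 * k))))
      = (\<Sum>b\<in>Basis - {e}. M / (2 * real k + 1))"
  proof (rule sum.cong)
    fix b :: "real ^ 'n" assume "b \<in> Basis - {e}"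
    then have "(2 * real k + 1) * (LINT x|lebesgue. h x * ((x \<bullet> b)\<^sup>2 * (x \<bullet> e) ^ (2 * k))) = M"
      unfolding M_def using e by (intro mixed_moment) (auto simp: inner_Basis)
    then show "(LINT x|lebesgue. h x * ((x \<bullet> b)\<^sup>2 * (x \<bullet> e) ^ (2 * k))) = M / (2 * real k + 1)"
      by (simp add: field_simps)
  qed simp
  also have "\<dots> = (real CARD('n) - 1) * (M / (2 * real k + 1))"
    using e by (simp add: card_Diff_singleton of_nat_diff Suc_leI)
  finally have "X = M + (real CARD('n) - 1) * (M / (2 * real k + 1))" unfolding X_def .
  then show ?thesis unfolding M_def[symmetric] X_def[symmetric] by (simp add: field_simps)
qed

end

text \<open>Trading a factor (x \<bullet> e)^2 for |x|^2 costs (1/2 + k) / (n/2 + k), and these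
  factors build the Pochhammer quotient. The induction passes from h to h |x|^2, so h has to vary,
  which is possible outside the locale that fixes it.\<close>

lemma radial_moment_Basis:
  fixes h :: "real ^ 'n \<Rightarrow> real"
  assumes "radial_function h R" "e \<in> Basis"
  shows "(LINT x|lebesgue. h x * (x \<bullet> e) ^ (2 * k))
    = pochhammer (1 / 2) k / pochhammer (real CARD('n) / 2) k * (LINT x|lebesgue. h x * (norm x) ^ (2 * k))"
  using assms(1)
proof (induction k arbitrary: h)
  case (Suc k)
  interpret radial_function h R by fact
  have N: "real CARD('n) / 2 + real k \<noteq> 0" by (simp add: add_pos_nonneg less_imp_neq[symmetric])
  have "(real CARD('n) / 2 + real k) * (LINT x|lebesgue. h x * (x \<bullet> e) ^ (2 * Suc k))
     = (1 / 2 + real k) * (pochhammer (1 / 2) k / pochhammer (real CARD('n) / 2) k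
        * (LINT x|lebesgue. h x * (norm x)\<^sup>2 * (norm x) ^ (2 * k)))"
    unfolding moment_Suc[OF assms(2)] Suc.IH[OF times_norm_squared] ..
  also have "(\<lambda>x. h x * (norm x)\<^sup>2 * (norm x) ^ (2 * k)) = (\<lambda>x. h x * (norm x) ^ (2 * Suc k))"
    by (simp add: power2_eq_square mult.assoc)
  finally have "(LINT x|lebesgue. h x * (x \<bullet> e) ^ (2 * Suc k))
     = (1 / 2 + real k) * (pochhammer (1 / 2) k / pochhammer (real CARD('n) / 2) k
        * (LINT x|lebesgue. h x * (norm x) ^ (2 * Suc k))) / (real CARD('n) / 2 + real k)"
    by (intro eq_divide_imp[OF N]) (subst mult.commute)
  then show ?case
    by (simp only: pochhammer_Suc times_divide_eq_left times_divide_eq_right divide_divide_eq_left mult_ac)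
qed simp

context radial_function
begin

lemma moment:
  "(LINT x|lebesgue. h x * (x \<bullet> \<xi>) ^ (2 * k))
    = pochhammer (1 / 2) k / pochhammer (real CARD('n) / 2) k * (LINT x|lebesgue. h x * (norm x * norm \<xi>) ^ (2 * k))"
proof -
  obtain e :: "real ^ 'n" where e: "e \<in> Basis" by (meson SOME_Basis)
  have "(LINT x|lebesgue. h x * (x \<bullet> \<xi>) ^ (2 * k)) = (LINT x|lebesgue. h x * (x \<bullet> (norm \<xi> *\<^sub>R e)) ^ (2 * k))"
    by (rule moment_cong_norm) (simp add: norm_Basis[OF e])
  also have "\<dots> = norm \<xi> ^ (2 * k) * (LINT x|lebesgue. h x * (x \<bullet> e) ^ (2 * k))"
    by (simp add: power_mult_distrib mult_ac flip: integral_mult_right_zero)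
  also have "(LINT x|lebesgue. h x * (x \<bullet> e) ^ (2 * k))
    = pochhammer (1 / 2) k / pochhammer (real CARD('n) / 2) k * (LINT x|lebesgue. h x * (norm x) ^ (2 * k))"
    by (rule radial_moment_Basis[OF _ e]) (rule radial_function_axioms)
  also have "norm \<xi> ^ (2 * k) * (pochhammer (1 / 2) k / pochhammer (real CARD('n) / 2) k * (LINT x|lebesgue. h x * (norm x) ^ (2 * k)))
    = pochhammer (1 / 2) k / pochhammer (real CARD('n) / 2) k * (LINT x|lebesgue. h x * (norm x * norm \<xi>) ^ (2 * k))"
    by (simp add: power_mult_distrib mult_ac flip: integral_mult_right_zero)
  finally show ?thesis .
qed

text \<open>On the support of h the argument Z is bounded by some B, and the series at |B| times the
  integral of |h| dominates the sum of the integrals. Z and b are general because the cosine and the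
  radial kernel are both expanded in this way.\<close>

lemma bessel_clifford_integral_sums:
  fixes Z :: "real ^ 'n \<Rightarrow> real"
  assumes Z: "continuous_on UNIV Z" and b: "0 < b"
  shows "(\<lambda>k. (- 1) ^ k / fact k * ((LINT x|lebesgue. h x * Z x ^ k) / pochhammer b k))
    sums (LINT x|lebesgue. h x * bessel_clifford b (Z x))"
proof -
  have "compact (Z ` cball 0 R)"
    using Z by (intro compact_continuous_image) (auto intro: continuous_on_subset)
  then obtain B where B: "\<And>x. x \<in> cball 0 R \<Longrightarrow> \<bar>Z x\<bar> \<le> B"
    by (metis bounded_iff compact_imp_bounded image_eqI real_norm_def)
  define f where "f k x = h x * ((- Z x) ^ k / (fact k * pochhammer b k))" for k x
  have pos: "0 < pochhammer b k" for k using b by (rule pochhammer_pos)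
  have sm: "summable (\<lambda>k. y ^ k / (fact k * pochhammer b k))" for y
    using b by (rule summable_power_over_fact_pochhammer)
  have fI: "integrable lebesgue (f k)" for k
    unfolding f_def[abs_def] using Z by (intro integrable_mult_continuous continuous_intros) (use pos[of k] in auto)
  have "(\<lambda>k. LINT x|lebesgue. f k x) sums (LINT x|lebesgue. (\<Sum>k. f k x))"
  proof (rule sums_integral[OF fI])
    show "AE x in lebesgue. summable (\<lambda>k. norm (f k x))"
    proof (rule AE_I2)
      fix x
      have "norm (f k x) = \<bar>h x\<bar> * (\<bar>Z x\<bar> ^ k / (fact k * pochhammer b k))" for k
        using pos[of k] by (simp add: f_def abs_mult abs_divide power_abs)
      then show "summable (\<lambda>k. norm (f k x))" using summable_mult[OF sm[of "\<bar>Z x\<bar>"], of "\<bar>h x\<bar>"] by simp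
    qed
    show "summable (\<lambda>k. LINT x|lebesgue. norm (f k x))"
    proof (rule summable_comparison_test'[where N=0])
      show "summable (\<lambda>k. (\<bar>B\<bar> ^ k / (fact k * pochhammer b k)) * (LINT x|lebesgue. \<bar>h x\<bar>))"
        by (rule summable_mult2) (rule sm)
      fix k
      have "norm (f k x) \<le> (\<bar>B\<bar> ^ k / (fact k * pochhammer b k)) * \<bar>h x\<bar>" for x
      proof (cases "x \<in> cball 0 R")
        case True
        then have "\<bar>Z x\<bar> ^ k \<le> \<bar>B\<bar> ^ k" using B[OF True] by (intro power_mono) auto
        then have "\<bar>Z x\<bar> ^ k / (fact k * pochhammer b k) \<le> \<bar>B\<bar> ^ k / (fact k * pochhammer b k)"
          using pos[of k] by (intro divide_right_mono) auto
        from mult_right_mono[OF this, of "\<bar>h x\<bar>"] show ?thesis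
          using pos[of k] by (simp add: f_def abs_mult abs_divide power_abs mult.commute)
      qed (simp add: f_def support)
      then have "(LINT x|lebesgue. norm (f k x)) \<le> (LINT x|lebesgue. (\<bar>B\<bar> ^ k / (fact k * pochhammer b k)) * \<bar>h x\<bar>)"
        using fI[of k] integrable by (intro integral_mono) auto
      then show "norm (LINT x|lebesgue. norm (f k x)) \<le> (\<bar>B\<bar> ^ k / (fact k * pochhammer b k)) * (LINT x|lebesgue. \<bar>h x\<bar>)"
        by simp
    qed
  qed
  moreover have "(\<Sum>k. f k x) = h x * bessel_clifford b (Z x)" for x
    unfolding f_def bessel_clifford_def by (rule suminf_mult) (rule sm)
  moreover have "(LINT x|lebesgue. f k x) = (- 1) ^ k / fact k * ((LINT x|lebesgue. h x * Z x ^ k) / pochhammer b k)" for k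
  proof -
    have "f k = (\<lambda>x. ((- 1) ^ k / (fact k * pochhammer b k)) * (h x * Z x ^ k))"
      unfolding f_def by (subst power_minus) (simp add: fun_eq_iff)
    then show ?thesis by simp
  qed
  ultimately show ?thesis by simp
qed

text \<open>The two sides are series of one family, with b = 1/2 at (x \<bullet> \<xi>)^2 / 4 and b
  = n/2 at (|x| |\<xi>| / 2)^2. The moment formula exchanges (1/2)_k for (n/2)_k, so they agree term
  by term.\<close>

theorem integral_cos_inner:
  "(LINT x|lebesgue. h x * cos (x \<bullet> \<xi>))
    = (LINT x|lebesgue. h x * bessel_clifford (real CARD('n) / 2) ((norm x * norm \<xi> / 2)\<^sup>2))"
proof -
  have n: "0 < real CARD('n) / 2" by simp
  have p: "0 < pochhammer (1 / 2 :: real) k" for k by (intro pochhammer_pos) simp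
  have "(LINT x|lebesgue. h x * ((x \<bullet> \<xi>)\<^sup>2 / 4) ^ k) / pochhammer (1 / 2) k
      = (LINT x|lebesgue. h x * ((norm x * norm \<xi> / 2)\<^sup>2) ^ k) / pochhammer (real CARD('n) / 2) k" for k
  proof -
    have "(LINT x|lebesgue. h x * ((x \<bullet> \<xi>)\<^sup>2 / 4) ^ k) = (LINT x|lebesgue. h x * (x \<bullet> \<xi>) ^ (2 * k)) / 4 ^ k"
      by (simp add: power_divide power_mult)
    moreover have "(LINT x|lebesgue. h x * ((norm x * norm \<xi> / 2)\<^sup>2) ^ k) = (LINT x|lebesgue. h x * (norm x * norm \<xi>) ^ (2 * k)) / 4 ^ k"
      by (simp add: power_divide power_mult)
    ultimately show ?thesis using p[of k] by (simp add: moment)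
  qed
  moreover have "(\<lambda>k. (- 1) ^ k / fact k * ((LINT x|lebesgue. h x * ((x \<bullet> \<xi>)\<^sup>2 / 4) ^ k) / pochhammer (1 / 2) k))
      sums (LINT x|lebesgue. h x * bessel_clifford (1 / 2) ((x \<bullet> \<xi>)\<^sup>2 / 4))"
    by (rule bessel_clifford_integral_sums) (auto intro!: continuous_intros)
  moreover have "(\<lambda>k. (- 1) ^ k / fact k * ((LINT x|lebesgue. h x * ((norm x * norm \<xi> / 2)\<^sup>2) ^ k) / pochhammer (real CARD('n) / 2) k))
      sums (LINT x|lebesgue. h x * bessel_clifford (real CARD('n) / 2) ((norm x * norm \<xi> / 2)\<^sup>2))"
    by (rule bessel_clifford_integral_sums[OF _ n]) (auto intro!: continuous_intros)
  ultimately show ?thesis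
    using sums_unique2 by (simp add: bessel_clifford_half)
qed

end

text \<open>The truncation on a centred ball inherits radiality from v, so its cosine integral is an
  integral against the kernel. For |x| < c / s and |\<xi>| < s the kernel is evaluated within
  [0, c], which gives the factor \<kappa> uniformly in s; the modulation is the constant 1.\<close>

lemma weight_product_balls_le:
  fixes u v :: "real ^ 'n \<Rightarrow> real"
  assumes pq: "1 < p" "1 < q"
    and u: "u \<in> borel_measurable lebesgue" "\<And>x. 0 \<le> u x"
    and v: "v \<in> borel_measurable lebesgue" "\<And>x. 0 \<le> v x"
    and radial: "\<And>x y. norm x = norm y \<Longrightarrow> v x = v y"
    and C: "0 \<le> C" "\<And>f. integrable lebesgue f \<Longrightarrow> integrable lebesgue (\<lambda>x. v x * norm (f x) powr p)
       \<Longrightarrow> pitt_for p q u v C f"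
    and s: "0 < s" and \<kappa>: "0 < \<kappa>" "\<And>t. 0 \<le> t \<Longrightarrow> t \<le> c \<Longrightarrow> \<kappa> \<le> bessel_clifford (real CARD('n) / 2) ((t / 2)\<^sup>2)"
  shows "weight_product p q u v {x. norm x < s} {x. norm x < c / s} \<le> ennreal (C powr (1 / q) / \<kappa>)"
proof -
  have ball: "{x. norm x < r} = ball (0 :: real ^ 'n) r" for r by auto
  have Am: "{x :: real ^ 'n. norm x < c / s} \<in> lmeasurable" and Bm: "{x :: real ^ 'n. norm x < s} \<in> sets lebesgue"
    unfolding ball by (auto intro: lmeasurable_open)
  show ?thesis
  proof (rule weight_product_le[OF pq u v C Am Bm _ _ \<kappa>(1)])
    show "(\<lambda>_. 1 :: complex) \<in> borel_measurable lebesgue" by simp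
    show "norm (1 :: complex) = 1" by simp
    fix n \<xi> assume "\<xi> \<in> {x :: real ^ 'n. norm x < s}"
    then have \<xi>: "norm \<xi> < s" by simp
    define h where "h = trunc_dual p v {x. norm x < c / s} n"
    have hi: "integrable lebesgue h" unfolding h_def by (rule integrable_trunc_dual[OF v(1) Am])
    have h0: "0 \<le> h x" for x by (simp add: h_def trunc_dual_nonneg)
    interpret radial_function h "c / s"
    proof
      show "h x = h y" if "norm x = norm y" for x y
        using radial[OF that] that by (simp add: h_def trunc_dual_def indicator_def)
    qed (use hi in \<open>auto simp: h_def trunc_dual_def indicator_def\<close>)
    have fi: "integrable lebesgue (\<lambda>x. exp (\<i> * complex_of_real (x \<bullet> \<xi>)) * complex_of_real (h x))"
      using hi by (intro integrable_fourier_integrand) simp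
    have "\<kappa> * (LINT x|lebesgue. h x) = (LINT x|lebesgue. \<kappa> * h x)" by simp
    also have "\<dots> \<le> (LINT x|lebesgue. h x * bessel_clifford (real CARD('n) / 2) ((norm x * norm \<xi> / 2)\<^sup>2))"
    proof (rule integral_mono)
      show "integrable lebesgue (\<lambda>x. \<kappa> * h x)" using hi by simp
      show "integrable lebesgue (\<lambda>x. h x * bessel_clifford (real CARD('n) / 2) ((norm x * norm \<xi> / 2)\<^sup>2))"
        by (intro integrable_mult_continuous continuous_on_compose2[OF continuous_on_bessel_clifford[of _ UNIV]])
          (auto intro!: continuous_intros)
      fix x :: "real ^ 'n"
      show "\<kappa> * h x \<le> h x * bessel_clifford (real CARD('n) / 2) ((norm x * norm \<xi> / 2)\<^sup>2)"
      proof (cases "norm x < c / s")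
        case True
        have "norm x * norm \<xi> \<le> c / s * s"
          using True \<xi> s by (intro mult_mono) (auto intro: order_trans[OF norm_ge_zero less_imp_le])
        then have "\<kappa> \<le> bessel_clifford (real CARD('n) / 2) ((norm x * norm \<xi> / 2)\<^sup>2)"
          using s by (intro \<kappa>(2)) auto
        from mult_left_mono[OF this h0[of x]] show ?thesis by (simp add: mult.commute)
      qed (simp add: h_def trunc_dual_def)
    qed
    also have "\<dots> = (LINT x|lebesgue. h x * cos (x \<bullet> \<xi>))" by (rule integral_cos_inner[symmetric])
    also have "\<dots> = (LINT x|lebesgue. Re (exp (\<i> * complex_of_real (x \<bullet> \<xi>)) * complex_of_real (h x)))"
      by (simp add: Re_exp mult.commute)
    also have "\<dots> = Re (LINT x|lebesgue. exp (\<i> * complex_of_real (x \<bullet> \<xi>)) * complex_of_real (h x))"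
      by (rule integral_Re[OF fi])
    also have "\<dots> \<le> norm (fourier (\<lambda>x. 1 * complex_of_real (h x)) \<xi>)"
      unfolding fourier_def by (simp add: complex_Re_le_cmod)
    finally show "\<kappa> * (LINT x|lebesgue. trunc_dual p v {x. norm x < c / s} n x)
        \<le> norm (fourier (\<lambda>x. 1 * complex_of_real (trunc_dual p v {x. norm x < c / s} n x)) \<xi>)"
      by (simp add: h_def)
  qed
qed

section \<open>Uniform bounds over bodies, radii and configurations of translates\<close>

theorem theorem1p2:
  fixes u v :: "real ^ 'n \<Rightarrow> real" and p q :: real
  assumes "1 < p" and "1 < q"
    and "u \<in> borel_measurable lebesgue" and "\<forall>x. 0 \<le> u x"
    and "v \<in> borel_measurable lebesgue" and "\<forall>x. 0 \<le> v x"
    and "ae_locally_integrable v"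
    and "pitt_inequality p q u v"
  shows
    "(\<forall>c::real. 0 < c \<and> c < pi / 2 \<longrightarrow>
        (SUP A\<in>{A. symmetric_convex_body A}.
           weight_product p q u v ((*\<^sub>R) c ` polar A) A) < \<infinity>)
     \<and>
     ((\<exists>u\<^sub>0::real \<Rightarrow> real. \<forall>x. u x = u\<^sub>0 (norm x)) \<and>
      (\<exists>v\<^sub>0::real \<Rightarrow> real. \<forall>x. v x = v\<^sub>0 (norm x)) \<longrightarrow>
        (\<forall>c::real. 0 < c \<and> c < bessel_J_first_zero (real CARD('n) / 2 - 1) \<longrightarrow>
          (SUP s\<in>{0<..}.
             weight_product p q u v {x. norm x < s} {x. norm x < c / s}) < \<infinity>))
     \<and>
     pi / 2 \<le> bessel_J_first_zero (real CARD('n) / 2 - 1)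
     \<and>
     (\<forall>(N1::nat) (N2::nat) (c::real). 1 \<le> N1 \<and> 1 \<le> N2 \<and> 0 < c \<and> c < pi / 2 \<longrightarrow>
        Sup {weight_product p q u v
               (\<Union>j\<in>{1..N2}. (+) (\<xi> j) ` (*\<^sub>R) c ` polar A)
               (\<Union>j\<in>{1..N1}. (+) (x j) ` A) |
             (A :: (real ^ 'n) set) (x :: nat \<Rightarrow> real ^ 'n) (\<xi> :: nat \<Rightarrow> real ^ 'n).
             symmetric_convex_body A \<and>
             disjoint_family_on (\<lambda>j. (+) (x j) ` A) {1..N1} \<and>
             disjoint_family_on (\<lambda>j. (+) (\<xi> j) ` (*\<^sub>R) c ` polar A) {1..N2}} < \<infinity>)"
proof -
  have pq: "1 < p" "1 < q" "0 < p" "0 < q" using assms(1,2) by auto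
  have u: "u \<in> borel_measurable lebesgue" "\<And>x. 0 \<le> u x" using assms by auto
  have v: "v \<in> borel_measurable lebesgue" "\<And>x. 0 \<le> v x" using assms by auto
  obtain C where C: "0 \<le> C" "\<And>f. integrable lebesgue f \<Longrightarrow> integrable lebesgue (\<lambda>x. v x * norm (f x) powr p)
       \<Longrightarrow> pitt_for p q u v C f"
    using pitt_inequality_extends[OF pq(3,4) u v assms(7,8)] by blast
  have translates: "weight_product p q u v ((+) \<eta> ` (*\<^sub>R) c ` polar A) ((+) y ` A) \<le> ennreal (C powr (1 / q) / cos c)"
    if "symmetric_convex_body A" "0 < c" "c < pi / 2" for A c \<eta> y
    using that by (intro weight_product_translates_le[OF pq(1,2) u v C]) (auto simp: symmetric_convex_body_def)
  have part1: "(SUP A\<in>{A. symmetric_convex_body A}. weight_product p q u v ((*\<^sub>R) c ` polar A) A) < \<infinity>"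
    if c: "0 < c" "c < pi / 2" for c
  proof -
    have "(SUP A\<in>{A. symmetric_convex_body A}. weight_product p q u v ((*\<^sub>R) c ` polar A) A)
        \<le> ennreal (C powr (1 / q) / cos c)"
    proof (rule SUP_least)
      fix A :: "(real ^ 'n) set" assume "A \<in> {A. symmetric_convex_body A}"
      then show "weight_product p q u v ((*\<^sub>R) c ` polar A) A \<le> ennreal (C powr (1 / q) / cos c)"
        using translates[of A c 0 0] c by simp
    qed
    also have "\<dots> < \<infinity>" by simp
    finally show ?thesis .
  qed
  have part2: "(SUP s\<in>{0<..}. weight_product p q u v {x. norm x < s} {x. norm x < c / s}) < \<infinity>"
    if "\<exists>v\<^sub>0::real \<Rightarrow> real. \<forall>x. v x = v\<^sub>0 (norm x)"
      and c: "0 < c" "c < bessel_J_first_zero (real CARD('n) / 2 - 1)" for c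
  proof -
    have radial: "v x = v y" if "norm x = norm y" for x y
      using \<open>\<exists>v\<^sub>0::real \<Rightarrow> real. \<forall>x. v x = v\<^sub>0 (norm x)\<close> that by auto
    have n: "0 < real CARD('n) / 2" by simp
    have cont: "continuous_on {0..c} (\<lambda>t. bessel_clifford (real CARD('n) / 2) ((t / 2)\<^sup>2))"
      by (rule continuous_on_compose2[OF continuous_on_bessel_clifford[OF n, of UNIV]]) (auto intro!: continuous_intros)
    \<comment> \<open>Compactness of [0, c] turns pointwise positivity below the first zero into one
      constant that serves every s.\<close>
    obtain t0 where t0: "t0 \<in> {0..c}" "\<And>t. t \<in> {0..c} \<Longrightarrow>
        bessel_clifford (real CARD('n) / 2) ((t0 / 2)\<^sup>2) \<le> bessel_clifford (real CARD('n) / 2) ((t / 2)\<^sup>2)"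
      using continuous_attains_inf[OF compact_Icc _ cont] c by auto
    define \<kappa> where "\<kappa> = bessel_clifford (real CARD('n) / 2) ((t0 / 2)\<^sup>2)"
    have \<kappa>: "0 < \<kappa>" unfolding \<kappa>_def using t0(1) c by (intro bessel_J_first_zero(3)[OF n]) auto
    have "(SUP s\<in>{0<..}. weight_product p q u v {x. norm x < s} {x. norm x < c / s})
        \<le> ennreal (C powr (1 / q) / \<kappa>)"
    proof (rule SUP_least)
      fix s :: real assume "s \<in> {0<..}"
      then show "weight_product p q u v {x. norm x < s} {x. norm x < c / s} \<le> ennreal (C powr (1 / q) / \<kappa>)"
        using t0(2) by (intro weight_product_balls_le[OF pq(1,2) u v radial C _ \<kappa>]) (auto simp: \<kappa>_def)
    qed
    also have "\<dots> < \<infinity>" by simp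
    finally show ?thesis .
  qed
  have part3: "Sup {weight_product p q u v
               (\<Union>j\<in>{1..N2}. (+) (\<xi> j) ` (*\<^sub>R) c ` polar A)
               (\<Union>j\<in>{1..N1}. (+) (x j) ` A) |
             (A :: (real ^ 'n) set) (x :: nat \<Rightarrow> real ^ 'n) (\<xi> :: nat \<Rightarrow> real ^ 'n).
             symmetric_convex_body A \<and>
             disjoint_family_on (\<lambda>j. (+) (x j) ` A) {1..N1} \<and>
             disjoint_family_on (\<lambda>j. (+) (\<xi> j) ` (*\<^sub>R) c ` polar A) {1..N2}} < \<infinity>" (is "Sup ?S < \<infinity>")
    if N: "1 \<le> N1" "1 \<le> N2" and c: "0 < c" "c < pi / 2" for N1 N2 :: nat and c
  proof -
    \<comment> \<open>This constant involves the numbers of pieces, c and the data of the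
      inequality, but neither the body nor the centres, so it bounds the supremum.\<close>
    define K where "K = ennreal (real (card {1..N2}) powr (1 / q) * real (card {1..N1}) powr (1 / conj_exponent p))
        * ennreal (C powr (1 / q) / cos c)"
    have "Sup ?S \<le> K"
    proof (rule Sup_least)
      fix w assume "w \<in> ?S"
      then obtain A x \<xi> where A: "symmetric_convex_body A" and w: "w = weight_product p q u v
               (\<Union>j\<in>{1..N2}. (+) (\<xi> j) ` (*\<^sub>R) c ` polar A) (\<Union>j\<in>{1..N1}. (+) (x j) ` A)"
        by blast
      have "compact A" using A by (simp add: symmetric_convex_body_def)
      then have "(+) y ` A \<in> sets lebesgue" for y
        using compact_translation[of A y] by (simp add: compact_imp_closed lebesgue_closedin)
      moreover have "(+) y ` (*\<^sub>R) c ` polar A \<in> sets lebesgue" for y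
        using closed_translation[OF closed_scaling[OF closed_polar, of c A], of y] by simp
      ultimately show "w \<le> K"
        unfolding w K_def using N by (intro weight_product_UN_le pq u v translates A c) auto
    qed
    also have "K < \<infinity>" by (simp add: K_def ennreal_mult_less_top)
    finally show ?thesis .
  qed
  have "1 \<le> CARD('n)" using zero_less_card_finite[where 'a='n] by linarith
  then have "pi / 2 \<le> bessel_J_first_zero (real CARD('n) / 2 - 1)"
    by (rule half_pi_le_bessel_J_first_zero)
  with part1 part2 part3 show ?thesis by blast
qed

end
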